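(* Let $\Omega=\Omega_1\cup\Omega_2\subset\mathbb{R}^2$ with $\Omega_1,\Omega_2$ disjoint, compact, smooth and strictly convex, and suppose that $\Omega_1$ and $\Omega_2$ satisfy the no-occlusion condition with respect to the direction of incidence $\alpha$ ($|\alpha|=1$). Considering any given function $h\in C(\partial\Omega)$ as $h(x)=e^{ik\,\alpha\cdot x}\,h_0(x)$ (that is, as having phase $\alpha\cdot x$ and amplitude $h_0$), the series $$\sum_{\ell=0}^{\infty}\|\mathcal{K}^{\ell}h\|_{\infty}$$ converges for all $k>0$, where $\mathcal{K}=\begin{bmatrix}0&\mathcal{K}_{12}\\ \mathcal{K}_{21}&0\end{bmatrix}$ and $\mathcal{K}_{12},\mathcal{K}_{21}$ are the Kirchhoff operators.
   Context: No-occlusion condition with respect to $\alpha$: there is at least one ray with direction $\alpha$ that passes between $\Omega_1$ and $\Omega_2$ without touching them. $\nu$ is the exterior unit normal to $\partial\Omega$, $k>0$ is the wavenumber, and $\|\cdot\|_\infty$ is the sup norm on $\partial\Omega$. Functions on $\partial\Omega$ are identified with pairs $(h_1,h_2)^t$ of functions on $\partial\Omega_1,\partial\Omega_2$. Throughout $j,j'\in\{1,2\}$ with $j\ne j'$, $[x,y]$ denotes the line segment joining $x$ and $y$, and $\gamma_j$ is the arc length parametrization (counterclockwise) of $\partial\Omega_j$, of period $L_j$; $t_j\in[0,L_j)$ is the unique parameter with $\gamma_j(t_j)=x_j$. Kirchhoff operators. Let $$F(x,y)=\frac{1}{\sqrt{|x-y|}}\,\frac{x-y}{|x-y|}\cdot\nu(x).$$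 Let $\phi_{j'}:\partial\Omega_{j'}\to\mathbb{R}$ be a smooth phase such that, for each $x_j\in\partial\Omega_j$, the function $\phi_{jj'}(x_j,x_{j'})=\phi_{j'}(x_{j'})+|x_j-x_{j'}|$ has a unique stationary point $y_{j'}=x_{j'}(x_j)\in\partial\Omega_{j'}$ (with respect to $x_{j'}$) such that $[x_j,y_{j'}]\cap\partial\Omega_{j'}=\{y_{j'}\}$. The transformed phase $\phi_j:\partial\Omega_j\to\mathbb{R}$ is $\phi_j(x_j)=\phi_{jj'}(x_j,y_{j'})$. Assume further that $\phi_{jj'}(t_j,t_{j'})=\phi_{jj'}(x_j,x_{j'})$ satisfies $\partial^2_{t_{j'}}\phi_{jj'}(t_j,\tau_{j'})>0$ at $\tau_{j'}=\gamma_{j'}^{-1}(y_{j'})$. For an amplitude $A_{j'}:\partial\Omega_{j'}\to\mathbb{C}$, the transformed amplitude $A_j:\partial\Omega_j\to\mathbb{C}$ is $$A_j(x_j)=\begin{cases}A_{j'}(y_{j'})\,F(x_j,y_{j'})\,\big(\partial^2_{t_{j'}}\phi_{jj'}(t_j,\tau_{j'})\big)^{-1/2},&\text{if }[x_j,y_{j'}]\cap\partial\Omega_j=\{x_j\},\\0,&\text{otherwise.}\end{cases}$$ The Kirchhoff operator is $\mathcal{K}_{jj'}(\phi_{j'},A_{j'})=(\phi_j,A_j)$, abbreviated as $\mathcal{K}_{jj'}(e^{ik\phi_{j'}}A_{j'})=e^{ik\phi_j}A_j$, and extended by linearity to finite sums: $\mathcal{K}_{jj'}\big(\sum_{\ell}e^{ik\phi^\ell_{j'}}A^\ell_{j'}\big)=\sum_\ell\mathcal{K}_{jj'}(e^{ik\phi^\ell_{j'}}A^\ell_{j'})$.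 The powers $\mathcal{K}^\ell h$ are computed by repeatedly applying these operators to the phase–amplitude pairs, starting from the phase $\alpha\cdot x$ and amplitude $h_0$ on each $\partial\Omega_j$. *)

theory Defs
  imports "HOL-Analysis.Analysis"
begin

definition rot_left :: "real^2 \<Rightarrow> real^2" where
  "rot_left v = vector [- (v $ 2), v $ 1]"

definition rot_right :: "real^2 \<Rightarrow> real^2" where
  "rot_right v = vector [v $ 2, - (v $ 1)]"

definition smooth :: "(real \<Rightarrow> 'a::real_normed_vector) \<Rightarrow> bool" where
  "smooth f \<longleftrightarrow> (\<exists>D :: nat \<Rightarrow> real \<Rightarrow> 'a. D 0 = f \<and>
     (\<forall>n t. (D n has_vector_derivative D (Suc n) t) (at t)))"

abbreviation tangent :: "(real \<Rightarrow> real^2) \<Rightarrow> real \<Rightarrow> real^2" where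
  "tangent \<gamma> \<equiv> (\<lambda>t. vector_derivative \<gamma> (at t))"

text \<open>The last conjunct says that the interior lies to the left of the curve, that is,
  that the boundary is traversed counterclockwise.\<close>

definition arc_length_param :: "(real^2) set \<Rightarrow> (real \<Rightarrow> real^2) \<Rightarrow> real \<Rightarrow> bool" where
  "arc_length_param \<Omega> \<gamma> L \<longleftrightarrow>
     L > 0 \<and> smooth \<gamma> \<and> (\<forall>t. \<gamma> (t + L) = \<gamma> t) \<and>
     inj_on \<gamma> {0..<L} \<and> \<gamma> ` {0..<L} = frontier \<Omega> \<and>
     (\<forall>t. norm (tangent \<gamma> t) = 1) \<and>
     (\<forall>t. \<exists>\<epsilon>>0. \<forall>s. 0 < s \<and> s < \<epsilon> \<longrightarrow> \<gamma> t + s *\<^sub>R rot_left (tangent \<gamma> t) \<in> interior \<Omega>)"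

definition curvature :: "(real \<Rightarrow> real^2) \<Rightarrow> real \<Rightarrow> real" where
  "curvature \<gamma> t = tangent (tangent \<gamma>) t \<bullet> rot_left (tangent \<gamma> t)"

text \<open>Strict convexity is understood in the differential-geometric sense usual for smooth
  obstacles: the curvature of the boundary is positive everywhere.\<close>

definition smooth_strictly_convex :: "(real^2) set \<Rightarrow> (real \<Rightarrow> real^2) \<Rightarrow> real \<Rightarrow> bool" where
  "smooth_strictly_convex \<Omega> \<gamma> L \<longleftrightarrow>
     compact \<Omega> \<and> convex \<Omega> \<and> arc_length_param \<Omega> \<gamma> L \<and> (\<forall>t. curvature \<gamma> t > 0)"

text \<open>The ray is the whole line through \<open>p\<close> with direction \<open>\<alpha>\<close>; it passes between the two
  sets without touching them when they lie in opposite open half-planes of that line.\<close>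

definition no_occlusion :: "real^2 \<Rightarrow> (real^2) set \<Rightarrow> (real^2) set \<Rightarrow> bool" where
  "no_occlusion \<alpha> \<Omega>1 \<Omega>2 \<longleftrightarrow> (\<exists>p.
     (\<forall>x\<in>\<Omega>1. (x - p) \<bullet> rot_left \<alpha> > 0) \<and> (\<forall>x\<in>\<Omega>2. (x - p) \<bullet> rot_left \<alpha> < 0) \<or>
     (\<forall>x\<in>\<Omega>1. (x - p) \<bullet> rot_left \<alpha> < 0) \<and> (\<forall>x\<in>\<Omega>2. (x - p) \<bullet> rot_left \<alpha> > 0))"

text \<open>In what follows a boundary is given by its arc length parametrization \<open>\<gamma>\<close> and its
  period \<open>L\<close>. The operator maps data on the boundary \<open>(\<gamma>', L')\<close> to data on the
  boundary \<open>(\<gamma>, L)\<close>; points of the former are called \<open>y\<close>, points of the latter \<open>x\<close>.\<close>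

definition param :: "(real \<Rightarrow> real^2) \<Rightarrow> real \<Rightarrow> real^2 \<Rightarrow> real" where
  "param \<gamma> L = the_inv_into {0..<L} \<gamma>"

definition exterior_normal :: "(real \<Rightarrow> real^2) \<Rightarrow> real \<Rightarrow> real^2 \<Rightarrow> real^2" where
  "exterior_normal \<gamma> L x = rot_right (tangent \<gamma> (param \<gamma> L x))"

definition kernel_F :: "(real \<Rightarrow> real^2) \<Rightarrow> real \<Rightarrow> real^2 \<Rightarrow> real^2 \<Rightarrow> real" where
  "kernel_F \<gamma> L x y =
     1 / sqrt (norm (x - y)) * (((x - y) /\<^sub>R norm (x - y)) \<bullet> exterior_normal \<gamma> L x)"

definition combined_phase ::
    "(real^2 \<Rightarrow> real) \<Rightarrow> real^2 \<Rightarrow> real^2 \<Rightarrow> real" where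
  "combined_phase \<phi>' x y = \<phi>' y + norm (x - y)"

definition visible_stationary ::
    "(real \<Rightarrow> real^2) \<Rightarrow> real \<Rightarrow> (real^2 \<Rightarrow> real) \<Rightarrow> real^2 \<Rightarrow> real^2 \<Rightarrow> bool" where
  "visible_stationary \<gamma>' L' \<phi>' x y \<longleftrightarrow>
     y \<in> \<gamma>' ` {0..<L'} \<and>
     ((\<lambda>t. combined_phase \<phi>' x (\<gamma>' t)) has_real_derivative 0) (at (param \<gamma>' L' y)) \<and>
     closed_segment x y \<inter> \<gamma>' ` {0..<L'} = {y}"

definition stationary_point ::
    "(real \<Rightarrow> real^2) \<Rightarrow> real \<Rightarrow> (real^2 \<Rightarrow> real) \<Rightarrow> real^2 \<Rightarrow> real^2" where
  "stationary_point \<gamma>' L' \<phi>' x = (THE y. visible_stationary \<gamma>' L' \<phi>' x y)"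

definition phase_hessian ::
    "(real \<Rightarrow> real^2) \<Rightarrow> real \<Rightarrow> (real^2 \<Rightarrow> real) \<Rightarrow> real^2 \<Rightarrow> real^2 \<Rightarrow> real" where
  "phase_hessian \<gamma>' L' \<phi>' x y =
     (deriv ^^ 2) (\<lambda>t. combined_phase \<phi>' x (\<gamma>' t)) (param \<gamma>' L' y)"

text \<open>The domain of the Kirchhoff operator: phases for which the transformed phase and
  amplitude are meaningful.\<close>

definition admissible_phase ::
    "(real \<Rightarrow> real^2) \<Rightarrow> real \<Rightarrow> (real \<Rightarrow> real^2) \<Rightarrow> real \<Rightarrow> (real^2 \<Rightarrow> real) \<Rightarrow> bool" where
  "admissible_phase \<gamma> L \<gamma>' L' \<phi>' \<longleftrightarrow>
     smooth (\<lambda>t. \<phi>' (\<gamma>' t)) \<and>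
     (\<forall>x \<in> \<gamma> ` {0..<L}. \<exists>!y. visible_stationary \<gamma>' L' \<phi>' x y) \<and>
     (\<forall>x \<in> \<gamma> ` {0..<L}. phase_hessian \<gamma>' L' \<phi>' x (stationary_point \<gamma>' L' \<phi>' x) > 0)"

type_synonym wave = "(real^2 \<Rightarrow> real) \<times> (real^2 \<Rightarrow> complex)"

definition kirchhoff ::
    "(real \<Rightarrow> real^2) \<Rightarrow> real \<Rightarrow> (real \<Rightarrow> real^2) \<Rightarrow> real \<Rightarrow> wave \<Rightarrow> wave" where
  "kirchhoff \<gamma> L \<gamma>' L' = (\<lambda>(\<phi>', A').
     (\<lambda>x. combined_phase \<phi>' x (stationary_point \<gamma>' L' \<phi>' x),
      \<lambda>x. let y = stationary_point \<gamma>' L' \<phi>' x in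
        if closed_segment x y \<inter> \<gamma> ` {0..<L} = {x}
        then A' y * of_real (kernel_F \<gamma> L x y * phase_hessian \<gamma>' L' \<phi>' x y powr (- 1 / 2))
        else 0))"

text \<open>The operator matrix with zero diagonal acts on pairs of waves, one on each boundary.
  Each row has a single nonzero entry, so no sums of waves arise.\<close>

definition kirchhoff_matrix ::
    "(real \<Rightarrow> real^2) \<Rightarrow> real \<Rightarrow> (real \<Rightarrow> real^2) \<Rightarrow> real \<Rightarrow> wave \<times> wave \<Rightarrow> wave \<times> wave" where
  "kirchhoff_matrix \<gamma>1 L1 \<gamma>2 L2 = (\<lambda>(w1, w2).
     (kirchhoff \<gamma>1 L1 \<gamma>2 L2 w2, kirchhoff \<gamma>2 L2 \<gamma>1 L1 w1))"

definition kirchhoff_power ::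
    "(real \<Rightarrow> real^2) \<Rightarrow> real \<Rightarrow> (real \<Rightarrow> real^2) \<Rightarrow> real \<Rightarrow> real^2 \<Rightarrow> (real^2 \<Rightarrow> complex) \<Rightarrow>
     nat \<Rightarrow> wave \<times> wave" where
  "kirchhoff_power \<gamma>1 L1 \<gamma>2 L2 \<alpha> h0 l =
     (kirchhoff_matrix \<gamma>1 L1 \<gamma>2 L2 ^^ l) ((\<lambda>x. \<alpha> \<bullet> x, h0), (\<lambda>x. \<alpha> \<bullet> x, h0))"

definition wave_value :: "real \<Rightarrow> wave \<Rightarrow> real^2 \<Rightarrow> complex" where
  "wave_value k = (\<lambda>(\<phi>, A) x. exp (\<i> * of_real (k * \<phi> x)) * A x)"

definition pair_value :: "(real^2) set \<Rightarrow> real \<Rightarrow> wave \<times> wave \<Rightarrow> real^2 \<Rightarrow> complex" where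
  "pair_value \<Omega>1 k = (\<lambda>(w1, w2) x.
     if x \<in> frontier \<Omega>1 then wave_value k w1 x else wave_value k w2 x)"

definition sup_norm_on :: "'a set \<Rightarrow> ('a \<Rightarrow> complex) \<Rightarrow> real" where
  "sup_norm_on S f = (SUP x\<in>S. norm (f x))"

end

theory Submission
  imports Defs
begin

text \<open>Every phase produced by the iteration is the infimal convolution
  \<open>\<Phi>\<^sub>l\<^sub>+\<^sub>1 x = min {\<Phi>\<^sub>l y + norm (x - y) | y \<in> \<Omega>'}\<close> over the whole convex obstacle. It is therefore
  convex, and it is differentiable on \<open>\<Omega>\<close> with unit gradient. By convexity the visible stationary
  point is the unique minimizer: the gradient of the combined phase cannot vanish on \<open>\<Omega>'\<close> (for the
  plane wave by the no-occlusion condition, later because a segment between two points of \<open>\<Omega>\<close> does not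
  meet \<open>\<Omega>'\<close>), so the minimizer lies on the boundary and obeys the law of reflection.

  Let \<open>c\<close> be the cosine of the angle of incidence at the reflecting point, \<open>r\<close> the distance to the
  next one and \<open>\<kappa>\<close> the curvature. Convexity of the phase gives the lower bound
  \<open>c\<^sup>2 / r + 2 * \<kappa> * c\<close> for the Hessian. Along a chain of reflections
  the cosines cancel, and each reflection contributes a factor of at most
  \<open>1 / sqrt (1 + 2 * \<kappa> * r)\<close>, which is bounded away from 1.\<close>

section \<open>Vectors in the plane\<close>

text \<open>The danger is focusing: for an arbitrary phase the Hessian could be far below
  \<open>c\<^sup>2 / r\<close>, and its inverse square root would make the amplitude grow. Convexity
  of the phase is the invariant that excludes this. It needs a convex domain, so the phases are
  carried on the full obstacle although the operator reads them only on the boundary. One step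
  multiplies the amplitude by the cosine at the receiving point over \<open>sqrt r\<close> (from the
  kernel) and by at most \<open>sqrt r / c\<close> times a contraction (from the Hessian), where
  \<open>c\<close> is the cosine at the emitting point. A step-by-step sup norm bound would thus
  contain a quotient of two cosines, which need not be below 1. Measuring each amplitude against its
  own cosine absorbs the quotient. The initial amplitude carries no cosine; there the no-occlusion
  condition is used a second time, to keep \<open>c\<close> away from 0 at the points that reflect
  towards the other obstacle. Admissibility also asks for smoothness of every phase. No formulas for
  higher derivatives are needed: the direction field lies in an algebra of functions closed under
  differentiation.\<close>

lemma inner_2: "(v::real^2) \<bullet> w = v $ 1 * w $ 1 + v $ 2 * w $ 2"
  by (simp add: inner_vec_def sum_2)

lemma rot_nth [simp]:
  "rot_left v $ 1 = - (v $ 2)" "rot_left v $ 2 = v $ 1"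
  "rot_right v $ 1 = v $ 2" "rot_right v $ 2 = - (v $ 1)"
  by (simp_all add: rot_left_def rot_right_def)

lemma rot_left_eq: "rot_left v = - rot_right v"
  by (simp add: vec_eq_iff forall_2)

lemma bounded_linear_rot_right: "bounded_linear rot_right"
  by (rule linear_conv_bounded_linear[THEN iffD1], rule linearI)
    (simp_all add: vec_eq_iff forall_2 algebra_simps)

lemma rot_right_inner: "rot_right v \<bullet> v = 0" "v \<bullet> rot_right v = 0"
  by (simp_all add: inner_2)

lemma norm_rot_right: "norm (rot_right v) = norm v"
  by (simp add: norm_eq_sqrt_inner inner_2)

lemma frame_decomp:
  assumes "norm T = 1"
  shows "v = (v \<bullet> T) *\<^sub>R T + (v \<bullet> rot_right T) *\<^sub>R rot_right T"
proof -
  have "T $ 1 * T $ 1 + T $ 2 * T $ 2 = 1"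
    using assms by (simp add: norm_eq_sqrt_inner inner_2)
  then have "v $ 1 = (v $ 1) * (T $ 1 * T $ 1 + T $ 2 * T $ 2)"
    "v $ 2 = (v $ 2) * (T $ 1 * T $ 1 + T $ 2 * T $ 2)" by simp_all
  then show ?thesis
    by (simp add: vec_eq_iff forall_2 inner_2 algebra_simps)
qed

lemma frame_inner:
  assumes "norm T = 1"
  shows "v \<bullet> w = (v \<bullet> T) * (w \<bullet> T) + (v \<bullet> rot_right T) * (w \<bullet> rot_right T)"
proof -
  have "v \<bullet> w = v \<bullet> ((w \<bullet> T) *\<^sub>R T + (w \<bullet> rot_right T) *\<^sub>R rot_right T)"
    using frame_decomp[OF assms, of w] by simp
  also have "\<dots> = (v \<bullet> T) * (w \<bullet> T) + (v \<bullet> rot_right T) * (w \<bullet> rot_right T)"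
    by (simp only: inner_right_distrib inner_scaleR_right) simp
  finally show ?thesis .
qed

section \<open>Smooth functions of one variable\<close>

text \<open>Choosing one derivative in \<open>S\<close> for each member and iterating the choice
  yields the sequence that \<open>smooth\<close> asks for. Smoothness thereby becomes a closure
  property of a class of functions.\<close>

lemma smooth_closed_set:
  assumes "f \<in> S"
    and "\<And>g. g \<in> S \<Longrightarrow> \<exists>g'\<in>S. \<forall>t. (g has_vector_derivative g' t) (at t)"
  shows "smooth f"
proof -
  from assms(2) obtain d where d: "\<And>g. g \<in> S \<Longrightarrow> d g \<in> S \<and> (\<forall>t. (g has_vector_derivative d g t) (at t))"
    by metis
  have "(d ^^ n) f \<in> S" for n by (induction n) (use assms(1) d in auto)
  then show ?thesis unfolding smooth_def using d by (intro exI[of _ "\<lambda>n. (d ^^ n) f"]) auto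
qed

lemma smooth_has_derivative:
  assumes "smooth f"
  shows "(f has_vector_derivative vector_derivative f (at t)) (at t)"
  using assms unfolding smooth_def by (metis differentiableI_vector vector_derivative_works)

lemma smooth_derivative:
  assumes "smooth f"
  shows "smooth (\<lambda>t. vector_derivative f (at t))"
proof -
  obtain D where D: "D 0 = f" "\<And>n t. (D n has_vector_derivative D (Suc n) t) (at t)"
    using assms unfolding smooth_def by blast
  have "D (Suc 0) = (\<lambda>t. vector_derivative f (at t))"
    using D(1) vector_derivative_at[OF D(2)[of 0]] by (intro ext) simp
  then show ?thesis
    unfolding smooth_def using D(2) by (intro exI[of _ "\<lambda>n. D (Suc n)"]) simp
qed

lemma smooth_antiderivative:
  assumes "\<And>t. (f has_vector_derivative g t) (at t)" "smooth g"
  shows "smooth f"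
proof -
  obtain D where D: "D 0 = g" "\<And>n t. (D n has_vector_derivative D (Suc n) t) (at t)"
    using assms(2) unfolding smooth_def by blast
  show ?thesis
    unfolding smooth_def
  proof (intro exI[of _ "\<lambda>n. case n of 0 \<Rightarrow> f | Suc m \<Rightarrow> D m"] conjI allI)
    fix n t
    show "((case n of 0 \<Rightarrow> f | Suc m \<Rightarrow> D m) has_vector_derivative
        (case Suc n of 0 \<Rightarrow> f | Suc m \<Rightarrow> D m) t) (at t)"
      by (cases n) (simp_all add: D assms(1))
  qed simp
qed

lemma smooth_bounded_linear:
  assumes "smooth f" "bounded_linear h"
  shows "smooth (\<lambda>t. h (f t))"
proof -
  obtain D where D: "D 0 = f" "\<And>n t. (D n has_vector_derivative D (Suc n) t) (at t)"
    using assms unfolding smooth_def by blast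
  show ?thesis
    unfolding smooth_def
    by (intro exI[of _ "\<lambda>n t. h (D n t)"] conjI allI
        bounded_linear.has_vector_derivative[OF assms(2)] D(2)) (simp add: D)
qed

lemma smooth_nth: "smooth f \<Longrightarrow> smooth (\<lambda>t. f t $ i :: real)"
  by (rule smooth_bounded_linear[OF _ bounded_linear_vec_nth])

lemma smooth_const: "smooth (\<lambda>t. c)"
  by (rule smooth_closed_set[of _ "range (\<lambda>c t. c)"]) (auto intro!: derivative_eq_intros)

lemma smooth_continuous: "smooth f \<Longrightarrow> continuous_on S f"
  using smooth_has_derivative
  by (meson continuous_at_imp_continuous_on has_vector_derivative_continuous)

lemma vector_derivative_periodic:
  assumes "\<And>t. f (t + p) = f t"
  shows "vector_derivative f (at (t + p)) = vector_derivative f (at t)"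
proof -
  have *: "(f has_vector_derivative d) (at (t + q))"
    if "\<And>t. f (t + (- q)) = f t" "(f has_vector_derivative d) (at t)" for d t q
  proof -
    have "((\<lambda>t. t + (- q)) has_vector_derivative 1) (at (t + q))"
      by (auto intro!: derivative_eq_intros)
    from vector_diff_chain_at[OF this, of f d] show ?thesis
      using that by (simp add: o_def)
  qed
  have shift: "f (t + (- p)) = f t" "f (t + (- (- p))) = f t" for t
    using assms[of "t - p"] assms[of t] by simp_all
  have "(f has_vector_derivative d) (at (t + p)) \<longleftrightarrow> (f has_vector_derivative d) (at t)" for d
    using *[OF shift(1), of d t] *[OF shift(2), of d "t + p"] by auto
  then show ?thesis by (simp add: vector_derivative_def)
qed

text \<open>If \<open>l\<close> were negative, \<open>g'\<close> would be negative just to the right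
  of its zero \<open>a\<close>, and the mean value theorem would give a value below the
  minimum.\<close>

lemma DERIV_second_nonneg_at_min:
  fixes g :: "real \<Rightarrow> real"
  assumes "\<And>t. (g has_real_derivative g' t) (at t)" "(g' has_real_derivative l) (at a)"
    and min: "\<And>t. g a \<le> g t"
  shows "l \<ge> 0"
proof (rule ccontr)
  assume "\<not> l \<ge> 0"
  have g0: "g' a = 0"
    using DERIV_local_min[OF assms(1)[of a], of 1] min by auto
  obtain d where d: "d > 0" "\<And>h. 0 < h \<Longrightarrow> h < d \<Longrightarrow> g' (a + h) < g' a"
    using DERIV_neg_dec_right[OF assms(2)] \<open>\<not> l \<ge> 0\<close> by force
  obtain z where "z > a" "z < a + d / 2" "g (a + d/2) - g a = (a + d/2 - a) * g' z"
    using MVT2[of a "a + d/2" g g'] assms(1) d(1) by auto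
  moreover have "g' z < 0" using d(2)[of "z - a"] g0 calculation by simp
  ultimately have "g (a + d/2) < g a" using mult_pos_neg[of "d/2" "g' z"] d(1) by simp
  then show False using min[of "a + d/2"] by simp
qed

text \<open>The function \<open>\<tau>\<close> may jump by multiples of \<open>P\<close>, so only its compositions with
  \<open>P\<close>-periodic functions are admitted.\<close>

inductive_set smooth_algebra :: "(real \<Rightarrow> real) \<Rightarrow> real \<Rightarrow> (real \<Rightarrow> real) set"
  for \<tau> :: "real \<Rightarrow> real" and P :: real where
  smooth: "smooth a \<Longrightarrow> a \<in> smooth_algebra \<tau> P"
| periodic: "smooth b \<Longrightarrow> (\<And>t. b (t + P) = b t) \<Longrightarrow> (\<lambda>t. b (\<tau> t)) \<in> smooth_algebra \<tau> P"
| add: "f \<in> smooth_algebra \<tau> P \<Longrightarrow> g \<in> smooth_algebra \<tau> P \<Longrightarrow> (\<lambda>t. f t + g t) \<in> smooth_algebra \<tau> P"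
| mult: "f \<in> smooth_algebra \<tau> P \<Longrightarrow> g \<in> smooth_algebra \<tau> P \<Longrightarrow> (\<lambda>t. f t * g t) \<in> smooth_algebra \<tau> P"
| inverse: "f \<in> smooth_algebra \<tau> P \<Longrightarrow> (\<And>t. f t \<noteq> 0) \<Longrightarrow> (\<lambda>t. inverse (f t)) \<in> smooth_algebra \<tau> P"
| sqrt: "f \<in> smooth_algebra \<tau> P \<Longrightarrow> (\<And>t. f t > 0) \<Longrightarrow> (\<lambda>t. sqrt (f t)) \<in> smooth_algebra \<tau> P"

lemma smooth_algebra_minus:
  assumes "f \<in> smooth_algebra \<tau> P"
  shows "(\<lambda>t. - f t) \<in> smooth_algebra \<tau> P"
  using smooth_algebra.mult[OF smooth_algebra.smooth[OF smooth_const[of "-1"]] assms] by simp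

lemma smooth_algebra_diff:
  assumes "f \<in> smooth_algebra \<tau> P" "g \<in> smooth_algebra \<tau> P"
  shows "(\<lambda>t. f t - g t) \<in> smooth_algebra \<tau> P"
  using smooth_algebra.add[OF assms(1) smooth_algebra_minus[OF assms(2)]] by simp

lemma smooth_algebra_divide:
  assumes "f \<in> smooth_algebra \<tau> P" "g \<in> smooth_algebra \<tau> P" "\<And>t. g t \<noteq> 0"
  shows "(\<lambda>t. f t / g t) \<in> smooth_algebra \<tau> P"
  using smooth_algebra.mult[OF assms(1) smooth_algebra.inverse[OF assms(2,3)]]
  by (simp add: divide_inverse)

text \<open>Here \<open>\<sigma>\<close> plays the part of the derivative of \<open>\<tau>\<close>,
  even where \<open>\<tau>\<close> itself jumps. Since \<open>\<sigma>\<close> belongs to the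
  algebra, the chain rule does not lead out of it.\<close>

lemma smooth_algebra_derivative:
  assumes "\<sigma> \<in> smooth_algebra \<tau> P"
    and \<tau>: "\<And>b t. smooth b \<Longrightarrow> (\<And>t. b (t + P) = b t) \<Longrightarrow>
      ((\<lambda>t. b (\<tau> t)) has_real_derivative vector_derivative b (at (\<tau> t)) * \<sigma> t) (at t)"
    and "f \<in> smooth_algebra \<tau> P"
  shows "\<exists>f'\<in>smooth_algebra \<tau> P. \<forall>t. (f has_real_derivative f' t) (at t)"
  using assms(3)
proof induction
  case (smooth a)
  then show ?case
    using smooth_has_derivative[OF smooth] smooth_algebra.smooth[OF smooth_derivative[OF smooth]]
    by (intro bexI[of _ "\<lambda>t. vector_derivative a (at t)"])
      (simp_all add: has_real_derivative_iff_has_vector_derivative)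
next
  case (periodic b)
  show ?case
    using \<tau>[OF periodic] smooth_algebra.mult[OF smooth_algebra.periodic[OF smooth_derivative[OF periodic(1)]
      vector_derivative_periodic[of b, OF periodic(2)]] assms(1)]
    by (intro bexI[of _ "\<lambda>t. vector_derivative b (at (\<tau> t)) * \<sigma> t"]) simp_all
next
  case (add f g)
  then obtain f' g' where "f' \<in> smooth_algebra \<tau> P" "g' \<in> smooth_algebra \<tau> P"
    "\<And>t. (f has_real_derivative f' t) (at t)" "\<And>t. (g has_real_derivative g' t) (at t)" by blast
  with add show ?case
    by (intro bexI[of _ "\<lambda>t. f' t + g' t"] allI DERIV_add smooth_algebra.add)
next
  case (mult f g)
  then obtain f' g' where "f' \<in> smooth_algebra \<tau> P" "g' \<in> smooth_algebra \<tau> P"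
    "\<And>t. (f has_real_derivative f' t) (at t)" "\<And>t. (g has_real_derivative g' t) (at t)" by blast
  with mult show ?case
    by (intro bexI[of _ "\<lambda>t. f' t * g t + g' t * f t"] allI DERIV_mult
        smooth_algebra.add smooth_algebra.mult)
next
  case (inverse f)
  then obtain f' where "f' \<in> smooth_algebra \<tau> P" "\<And>t. (f has_real_derivative f' t) (at t)" by blast
  with inverse show ?case
    by (intro bexI[of _ "\<lambda>t. - (inverse (f t) * f' t * inverse (f t))"] allI DERIV_inverse'
        smooth_algebra_minus smooth_algebra.mult smooth_algebra.inverse)
next
  case (sqrt f)
  then obtain f' where f': "f' \<in> smooth_algebra \<tau> P" "\<And>t. (f has_real_derivative f' t) (at t)" by blast
  have *: "(\<lambda>t. sqrt (f t)) \<in> smooth_algebra \<tau> P" by (rule smooth_algebra.sqrt[OF sqrt(1,2)])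
  have "((\<lambda>t. sqrt (f t)) has_real_derivative f' t * (inverse (sqrt (f t)) * (1/2))) (at t)" for t
    using DERIV_chain2[OF DERIV_real_sqrt[OF sqrt(2)] f'(2)] by (simp add: field_simps)
  moreover have "(\<lambda>t. f' t * (inverse (sqrt (f t)) * (1/2))) \<in> smooth_algebra \<tau> P"
    using sqrt(2) by (intro smooth_algebra.mult f' smooth_algebra.inverse[OF *] smooth_algebra.smooth smooth_const)
      (metis less_irrefl real_sqrt_eq_0_iff)
  ultimately show ?case
    by (intro bexI[of _ "\<lambda>t. f' t * (inverse (sqrt (f t)) * (1/2))"]) simp_all
qed

lemma smooth_algebra_imp_smooth:
  assumes "\<sigma> \<in> smooth_algebra \<tau> P"
    and "\<And>b t. smooth b \<Longrightarrow> (\<And>t. b (t + P) = b t) \<Longrightarrow>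
      ((\<lambda>t. b (\<tau> t)) has_real_derivative vector_derivative b (at (\<tau> t)) * \<sigma> t) (at t)"
    and "f \<in> smooth_algebra \<tau> P"
  shows "smooth f"
  using smooth_algebra_derivative[OF assms(1,2)]
  by (intro smooth_closed_set[OF assms(3)]) (simp add: has_real_derivative_iff_has_vector_derivative)

text \<open>Implicit differentiation for a solution already known to be continuous at
  \<open>t0\<close>, so differentiability of \<open>G\<close> at one point suffices. Since
  \<open>G\<close> vanishes along the graph, its linear part there equals the remainder. This first
  gives a Lipschitz bound at \<open>t0\<close>, which then makes the remainder small against
  \<open>t - t0\<close> alone.\<close>

lemma implicit_has_real_derivative:
  fixes G :: "real \<times> real \<Rightarrow> real"
  assumes G: "(G has_derivative (\<lambda>(a, b). A * a + B * b)) (at (t0, s t0))" and "B \<noteq> 0"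
    and zero: "\<And>t. G (t, s t) = 0" and cont: "isCont s t0"
  shows "(s has_real_derivative - (A / B)) (at t0)"
proof -
  \<comment> \<open>The constant that results when the remainder is bounded with
    \<open>e = \<bar>B\<bar> / 2\<close> and half of
    \<open>\<bar>B\<bar> * \<bar>s t - s t0\<bar>\<close> is absorbed on the left.\<close>
  define K where "K = (2 * \<bar>A\<bar> + \<bar>B\<bar>) / \<bar>B\<bar>"
  have K: "K \<ge> 0" by (simp add: K_def)
  have B: "\<bar>B\<bar> > 0" using \<open>B \<noteq> 0\<close> by simp
  have small: "eventually (\<lambda>t. \<bar>A * (t - t0) + B * (s t - s t0)\<bar> \<le> e * (\<bar>t - t0\<bar> + \<bar>s t - s t0\<bar>)) (at t0)"
    if "e > 0" for e
  proof -
    obtain d where d: "d > 0" "\<And>p. norm (p - (t0, s t0)) < d \<Longrightarrow>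
      norm (G p - G (t0, s t0) - (case p - (t0, s t0) of (a, b) \<Rightarrow> A * a + B * b)) \<le> e * norm (p - (t0, s t0))"
      using G \<open>e > 0\<close> unfolding has_derivative_at_alt by blast
    have "((\<lambda>t. (t, s t)) \<longlongrightarrow> (t0, s t0)) (at t0)"
      using cont by (intro tendsto_intros) (simp add: isCont_def)
    then have "eventually (\<lambda>t. dist (t, s t) (t0, s t0) < d) (at t0)"
      using d(1) by (rule tendstoD)
    then show ?thesis
    proof eventually_elim
      case (elim t)
      have n: "norm ((t, s t) - (t0, s t0)) \<le> \<bar>t - t0\<bar> + \<bar>s t - s t0\<bar>"
        by (simp add: norm_Pair sqrt_sum_squares_le_sum_abs)
      have "\<bar>A * (t - t0) + B * (s t - s t0)\<bar> \<le> e * norm ((t, s t) - (t0, s t0))"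
        using d(2)[of "(t, s t)"] elim by (simp add: dist_norm zero)
      also have "\<dots> \<le> e * (\<bar>t - t0\<bar> + \<bar>s t - s t0\<bar>)"
        using n \<open>e > 0\<close> by (intro mult_left_mono) auto
      finally show ?case .
    qed
  qed
  have lip: "eventually (\<lambda>t. \<bar>s t - s t0\<bar> \<le> K * \<bar>t - t0\<bar>) (at t0)"
    using small[OF half_gt_zero[OF B]]
  proof (eventually_elim)
    case (elim t)
    have "\<bar>B\<bar> * \<bar>s t - s t0\<bar> \<le> \<bar>A\<bar> * \<bar>t - t0\<bar> + \<bar>A * (t - t0) + B * (s t - s t0)\<bar>"
      unfolding abs_mult[symmetric] by linarith
    also have "\<dots> \<le> \<bar>A\<bar> * \<bar>t - t0\<bar> + \<bar>B\<bar> / 2 * (\<bar>t - t0\<bar> + \<bar>s t - s t0\<bar>)"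
      using elim by simp
    finally have "\<bar>B\<bar> * \<bar>s t - s t0\<bar> \<le> (2 * \<bar>A\<bar> + \<bar>B\<bar>) * \<bar>t - t0\<bar>"
      by (simp add: algebra_simps)
    then show ?case using B by (simp add: K_def field_simps)
  qed
  have "((\<lambda>t. (s t - s t0) / (t - t0)) \<longlongrightarrow> - (A / B)) (at t0)"
  proof (rule tendstoI)
    fix e :: real assume "e > 0"
    \<comment> \<open>Chosen so that the final bound \<open>e' * (1 + K) / \<bar>B\<bar>\<close> is
      \<open>e / 2\<close>.\<close>
    define e' where "e' = e * \<bar>B\<bar> / (2 * (1 + K))"
    have e': "e' > 0" using \<open>e > 0\<close> B K by (simp add: e'_def)
    have "eventually (\<lambda>t. t \<noteq> t0) (at t0)" by (simp add: eventually_at_filter)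
    with small[OF e'] lip
    show "eventually (\<lambda>t. dist ((s t - s t0) / (t - t0)) (- (A / B)) < e) (at t0)"
    proof eventually_elim
      case (elim t)
      have nz: "\<bar>t - t0\<bar> > 0" using elim by simp
      have "dist ((s t - s t0) / (t - t0)) (- (A / B)) = \<bar>A * (t - t0) + B * (s t - s t0)\<bar> / (\<bar>B\<bar> * \<bar>t - t0\<bar>)"
        using \<open>B \<noteq> 0\<close> elim(3) unfolding dist_real_def abs_mult[symmetric] abs_divide[symmetric]
        by (intro arg_cong[of _ _ abs]) (simp add: field_simps)
      also have "\<dots> \<le> (e' * (\<bar>t - t0\<bar> + K * \<bar>t - t0\<bar>)) / (\<bar>B\<bar> * \<bar>t - t0\<bar>)"
        using elim(1,2) e' by (intro divide_right_mono order_trans[OF elim(1)] mult_left_mono) auto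
      also have "\<dots> = e' * (1 + K) / \<bar>B\<bar>" using nz B by (simp add: field_simps)
      also have "\<dots> = e / 2"
    proof -
      have "e * Y / (2 * X) * X / Y = e / 2" if "X \<noteq> 0" "Y \<noteq> 0" for X Y :: real
        using that by simp
      moreover have "1 + K \<noteq> 0" "\<bar>B\<bar> \<noteq> 0" using K B by linarith+
      ultimately show ?thesis unfolding e'_def by blast
    qed
      also have "\<dots> < e" using \<open>e > 0\<close> by simp
      finally show ?case .
    qed
  qed
  then show ?thesis by (simp add: has_field_derivative_iff)
qed

section \<open>Strictly convex obstacles\<close>

lemma periodic_int_multiple:
  fixes f :: "real \<Rightarrow> 'b"
  assumes "\<And>t. f (t + P) = f t"
  shows "f (t + of_int n * P) = f t"
proof -
  have nat: "f (t + real m * P) = f t" for t m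
  proof (induction m)
    case (Suc m)
    then show ?case using assms[of "t + real m * P"] by (simp add: algebra_simps)
  qed simp
  show ?thesis
  proof (cases "n \<ge> 0")
    case True
    then show ?thesis using nat[of t "nat n"] by simp
  next
    case False
    then show ?thesis using nat[of "t + of_int n * P" "nat (- n)"] by simp
  qed
qed

lemma DERIV_eq_0_at_max:
  fixes g :: "real \<Rightarrow> real"
  assumes "(g has_real_derivative l) (at a)" "\<And>t. g t \<le> g a"
  shows "l = 0"
  using DERIV_local_max[OF assms(1), of 1] assms(2) by simp

locale obstacle =
  fixes \<Omega> :: "(real^2) set" and \<gamma> :: "real \<Rightarrow> real^2" and L :: real
  assumes obstacle: "smooth_strictly_convex \<Omega> \<gamma> L"
begin

abbreviation normal :: "real \<Rightarrow> real^2" where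
  "normal t \<equiv> rot_right (tangent \<gamma> t)"

lemma
  shows compact: "compact \<Omega>" and convex: "convex \<Omega>" and L_pos: "L > 0"
    and smooth: "smooth \<gamma>" and periodic: "\<gamma> (t + L) = \<gamma> t"
    and inj: "inj_on \<gamma> {0..<L}" and image: "\<gamma> ` {0..<L} = frontier \<Omega>"
    and norm_tangent: "norm (tangent \<gamma> t) = 1"
    and inward: "\<exists>\<epsilon>>0. \<forall>s. 0 < s \<and> s < \<epsilon> \<longrightarrow> \<gamma> t + s *\<^sub>R rot_left (tangent \<gamma> t) \<in> interior \<Omega>"
    and curvature_pos: "curvature \<gamma> t > 0"
  using obstacle unfolding smooth_strictly_convex_def arc_length_param_def by blast+

lemma closed: "closed \<Omega>"
  using compact by (rule compact_imp_closed)

lemma frontier_subset: "frontier \<Omega> \<subseteq> \<Omega>"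
  using closed by (rule frontier_subset_closed)

lemma tangent_inner: "tangent \<gamma> t \<bullet> tangent \<gamma> t = 1"
  using norm_tangent[of t] by (simp add: norm_eq_1)

lemma norm_normal: "norm (normal t) = 1"
  by (simp add: norm_rot_right norm_tangent)

lemma normal_inner: "normal t \<bullet> normal t = 1"
  using norm_normal[of t] by (simp add: norm_eq_1)

lemma has_tangent: "(\<gamma> has_vector_derivative tangent \<gamma> t) (at t)"
  by (rule smooth_has_derivative[OF smooth])

lemma has_tangent2: "(tangent \<gamma> has_vector_derivative tangent (tangent \<gamma>) t) (at t)"
  by (rule smooth_has_derivative[OF smooth_derivative[OF smooth]])

lemma tangent_periodic: "tangent \<gamma> (t + L) = tangent \<gamma> t"
  by (rule vector_derivative_periodic[of \<gamma>, OF periodic])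

lemma tangent2_periodic: "tangent (tangent \<gamma>) (t + L) = tangent (tangent \<gamma>) t"
  by (rule vector_derivative_periodic[of "tangent \<gamma>", OF tangent_periodic])

text \<open>Frenet formula: unit speed makes the acceleration orthogonal to the tangent. The sign is
  negative because \<open>curvature\<close> is measured along the inner normal
  \<open>rot_left\<close>, while \<open>normal\<close> points outwards.\<close>

lemma tangent2: "tangent (tangent \<gamma>) t = (- curvature \<gamma> t) *\<^sub>R normal t"
proof -
  have "((\<lambda>t. tangent \<gamma> t \<bullet> tangent \<gamma> t) has_real_derivative
      tangent \<gamma> t \<bullet> tangent (tangent \<gamma>) t + tangent (tangent \<gamma>) t \<bullet> tangent \<gamma> t) (at t)"
    using bounded_bilinear.has_vector_derivative[OF bounded_bilinear_inner has_tangent2 has_tangent2]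
    by (simp add: has_real_derivative_iff_has_vector_derivative)
  moreover have "((\<lambda>t. tangent \<gamma> t \<bullet> tangent \<gamma> t) has_real_derivative 0) (at t)"
    by (simp add: tangent_inner)
  ultimately have "tangent (tangent \<gamma>) t \<bullet> tangent \<gamma> t = 0"
    using DERIV_unique by (fastforce simp: inner_commute)
  then show ?thesis
    using frame_decomp[OF norm_tangent[of t], of "tangent (tangent \<gamma>) t"]
    by (simp add: curvature_def rot_left_eq)
qed

lemma normal_deriv: "(normal has_vector_derivative curvature \<gamma> t *\<^sub>R tangent \<gamma> t) (at t)"
proof -
  have "(normal has_vector_derivative rot_right (tangent (tangent \<gamma>) t)) (at t)"
    by (rule bounded_linear.has_vector_derivative[OF bounded_linear_rot_right has_tangent2])
  moreover have "rot_right (tangent (tangent \<gamma>) t) = curvature \<gamma> t *\<^sub>R tangent \<gamma> t"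
    unfolding tangent2 by (simp add: vec_eq_iff forall_2)
  ultimately show ?thesis by simp
qed

lemma curvature_periodic: "curvature \<gamma> (t + L) = curvature \<gamma> t"
  unfolding curvature_def tangent_periodic tangent2_periodic ..

lemma reduce_param: "\<exists>n::int. t + of_int n * L \<in> {0..<L}"
proof -
  define n where "n = \<lfloor>t / L\<rfloor>"
  have "of_int n \<le> t / L" "t / L < of_int n + 1" unfolding n_def by linarith+
  then have "t + of_int (- n) * L \<in> {0..<L}" using L_pos by (simp add: field_simps)
  then show ?thesis by blast
qed

lemma curvature_lower_bound: "\<exists>\<kappa>>0. \<forall>t. \<kappa> \<le> curvature \<gamma> t"
proof -
  have "continuous_on {0..L} (\<lambda>t. tangent (tangent \<gamma>) t \<bullet> (- normal t))"
    by (intro continuous_intros smooth_continuous smooth_derivative smooth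
        bounded_linear.continuous_on[OF bounded_linear_rot_right])
  then have "continuous_on {0..L} (curvature \<gamma>)"
    by (simp add: curvature_def[abs_def] rot_left_eq)
  then obtain s where s: "\<And>t. t \<in> {0..L} \<Longrightarrow> curvature \<gamma> s \<le> curvature \<gamma> t"
    using continuous_attains_inf[of "{0..L}" "curvature \<gamma>"] L_pos by fastforce
  have "curvature \<gamma> s \<le> curvature \<gamma> t" for t
  proof -
    obtain n where "t + of_int n * L \<in> {0..<L}" using reduce_param by blast
    then show ?thesis
      using s[of "t + of_int n * L"] periodic_int_multiple[of "curvature \<gamma>" L t n, OF curvature_periodic] by simp
  qed
  then show ?thesis using curvature_pos by blast
qed

lemma in_frontier: "\<gamma> t \<in> frontier \<Omega>"
  using reduce_param[of t] periodic_int_multiple[of \<gamma>, OF periodic] image by (metis imageI)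

lemma in_set: "\<gamma> t \<in> \<Omega>"
  using in_frontier frontier_subset by blast

lemma same_point:
  assumes "\<gamma> s = \<gamma> t"
  obtains n :: int where "s = t + of_int n * L"
proof -
  obtain m n where "s + of_int m * L \<in> {0..<L}" "t + of_int n * L \<in> {0..<L}"
    using reduce_param by blast
  moreover from this have "s + of_int m * L = t + of_int n * L"
    using inj assms periodic_int_multiple[of \<gamma>, OF periodic] by (metis inj_onD)
  ultimately show ?thesis using that[of "n - m"] by (simp add: algebra_simps)
qed

lemma periodic_same_point:
  assumes "\<gamma> s = \<gamma> t" "\<And>t. f (t + L) = f t"
  shows "f s = f t"
  using same_point[OF assms(1)] periodic_int_multiple[of f, OF assms(2)] by metis

lemma param:
  assumes "y \<in> frontier \<Omega>"
  shows "param \<gamma> L y \<in> {0..<L}" "\<gamma> (param \<gamma> L y) = y"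
  using assms the_inv_into_into[OF inj _ subset_refl] f_the_inv_into_f[OF inj] image
  unfolding param_def by auto

text \<open>The functional \<open>a\<close> restricted to the curve is maximal at \<open>t\<close>,
  so \<open>a\<close> is orthogonal to the tangent; testing it on a point slightly inside
  \<open>\<Omega>\<close> fixes the sign.\<close>

lemma supporting_normal:
  assumes "a \<noteq> 0" "\<And>z. z \<in> \<Omega> \<Longrightarrow> a \<bullet> (z - \<gamma> t) \<le> 0"
  obtains c where "c > 0" "a = c *\<^sub>R normal t"
proof -
  have "((\<lambda>s. a \<bullet> (\<gamma> s - \<gamma> t)) has_real_derivative a \<bullet> tangent \<gamma> t) (at t)"
    unfolding has_real_derivative_iff_has_vector_derivative
    using bounded_linear.has_vector_derivative[OF bounded_linear_inner_right has_tangent, of a t]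
    by (auto simp: inner_diff_right intro!: derivative_eq_intros)
  then have "a \<bullet> tangent \<gamma> t = 0"
    by (rule DERIV_eq_0_at_max) (simp add: assms(2) in_set)
  then have a: "a = (a \<bullet> normal t) *\<^sub>R normal t"
    using frame_decomp[OF norm_tangent[of t], of a] by simp
  obtain \<epsilon> where "\<epsilon> > 0" "\<And>s. 0 < s \<Longrightarrow> s < \<epsilon> \<Longrightarrow> \<gamma> t + s *\<^sub>R rot_left (tangent \<gamma> t) \<in> interior \<Omega>"
    using inward by blast
  then have "\<gamma> t + (\<epsilon> / 2) *\<^sub>R rot_left (tangent \<gamma> t) \<in> \<Omega>"
    using interior_subset by force
  from assms(2)[OF this] have "a \<bullet> normal t \<ge> 0"
    using \<open>\<epsilon> > 0\<close> by (simp add: rot_left_eq zero_le_mult_iff)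
  moreover have "a \<bullet> normal t \<noteq> 0" using a assms(1) by auto
  ultimately show ?thesis using that[of "a \<bullet> normal t"] a by simp
qed

text \<open>Convexity provides some supporting functional at a frontier point, and by
  \<open>supporting_normal\<close> it can only be a positive multiple of the normal.\<close>

lemma normal_supports:
  assumes "z \<in> \<Omega>"
  shows "normal t \<bullet> (z - \<gamma> t) \<le> 0"
proof -
  have "\<gamma> t \<in> closure \<Omega>" "\<gamma> t \<notin> rel_interior \<Omega>"
  proof -
    show "\<gamma> t \<in> closure \<Omega>" using in_set closure_subset by blast
    have "interior \<Omega> \<noteq> {}" using inward[of t] field_lbound_gt_zero by (metis dense empty_iff)
    then show "\<gamma> t \<notin> rel_interior \<Omega>"
      using in_frontier[of t] by (simp add: interior_rel_interior_gen frontier_def rel_interior_nonempty_interior)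
  qed
  then obtain a where a: "a \<noteq> 0" "\<And>y. y \<in> closure \<Omega> \<Longrightarrow> a \<bullet> \<gamma> t \<le> a \<bullet> y"
    using supporting_hyperplane_rel_boundary[OF convex] closure_subset
    by (metis supporting_hyperplane_relative_frontier convex)
  have "- a \<bullet> (z - \<gamma> t) \<le> 0" if "z \<in> \<Omega>" for z
    using a(2)[of z] closure_subset that by (auto simp: inner_diff_right)
  from supporting_normal[OF _ this] a(1) obtain c where c: "c > 0" "- a = c *\<^sub>R normal t"
    by (metis neg_equal_0_iff_equal)
  have "(- a) \<bullet> (z - \<gamma> t) \<le> 0"
    using a(2)[of z] closure_subset assms by (auto simp: inner_diff_right)
  then show ?thesis unfolding c(2) using c(1) by (simp add: mult_le_0_iff)
qed

text \<open>For a second point \<open>z\<close> on the tangent at \<open>t\<close>, the function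
  \<open>s \<mapsto> normal s \<bullet> (z - \<gamma> s) \<le> 0\<close> is maximal at \<open>t\<close>, but its derivative there is
  the curvature times the signed distance from \<open>\<gamma> t\<close> to \<open>z\<close>.\<close>

lemma normal_supports_strictly:
  assumes "z \<in> \<Omega>" "z \<noteq> \<gamma> t"
  shows "normal t \<bullet> (z - \<gamma> t) < 0"
proof (rule ccontr)
  assume "\<not> ?thesis"
  with normal_supports[OF assms(1), of t] have 0: "normal t \<bullet> (z - \<gamma> t) = 0" by simp
  have "((\<lambda>s. normal s \<bullet> (z - \<gamma> s)) has_vector_derivative
      normal t \<bullet> (0 - tangent \<gamma> t) + (curvature \<gamma> t *\<^sub>R tangent \<gamma> t) \<bullet> (z - \<gamma> t)) (at t)"
    by (intro bounded_bilinear.has_vector_derivative[OF bounded_bilinear_inner] normal_deriv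
        has_vector_derivative_diff has_vector_derivative_const has_tangent)
  then have "normal t \<bullet> (0 - tangent \<gamma> t) + (curvature \<gamma> t *\<^sub>R tangent \<gamma> t) \<bullet> (z - \<gamma> t) = 0"
    unfolding has_real_derivative_iff_has_vector_derivative[symmetric]
    by (rule DERIV_eq_0_at_max) (simp add: 0 normal_supports assms(1))
  then have "tangent \<gamma> t \<bullet> (z - \<gamma> t) = 0"
    using curvature_pos[of t] by (simp add: rot_right_inner)
  then have "z - \<gamma> t = 0"
    using 0 frame_decomp[OF norm_tangent[of t], of "z - \<gamma> t"] by (simp add: inner_commute)
  then show False using assms(2) by simp
qed

end

section \<open>Reflection of an eikonal phase\<close>

text \<open>The tangential part of the ray direction, with a moving target \<open>X\<close> and a
  moving emitting point. The coefficient of \<open>b\<close> enters the Hessian, that of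
  \<open>a\<close> the speed of the reflecting point.\<close>

lemma (in obstacle) has_derivative_projection:
  assumes X: "(X has_vector_derivative X') (at t0)" and ne: "X t0 \<noteq> \<gamma> s0"
  defines "d \<equiv> sgn (X t0 - \<gamma> s0)" and "r \<equiv> norm (X t0 - \<gamma> s0)"
  shows "((\<lambda>p. sgn (X (fst p) - \<gamma> (snd p)) \<bullet> tangent \<gamma> (snd p)) has_derivative
    (\<lambda>(a, b). (X' \<bullet> tangent \<gamma> s0 - (d \<bullet> tangent \<gamma> s0) * (X' \<bullet> d)) / r * a +
      (((d \<bullet> tangent \<gamma> s0)\<^sup>2 - 1) / r + d \<bullet> tangent (tangent \<gamma>) s0) * b)) (at (t0, s0))"
proof -
  have r: "r > 0" using ne by (simp add: r_def)
  have W: "((\<lambda>p. X (fst p) - \<gamma> (snd p)) has_derivative (\<lambda>p. fst p *\<^sub>R X' - snd p *\<^sub>R tangent \<gamma> s0)) (at (t0, s0))"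
    using has_derivative_compose[OF has_derivative_fst[OF has_derivative_ident], where x = "(t0, s0)" and s = UNIV and g = X]
      has_derivative_compose[OF has_derivative_snd[OF has_derivative_ident], where x = "(t0, s0)" and s = UNIV and g = \<gamma>]
      X has_tangent[of s0]
    unfolding has_vector_derivative_def by (intro has_derivative_diff) simp_all
  have V: "((\<lambda>p. tangent \<gamma> (snd p)) has_derivative (\<lambda>p. snd p *\<^sub>R tangent (tangent \<gamma>) s0)) (at (t0, s0))"
    using has_derivative_compose[OF has_derivative_snd[OF has_derivative_ident], where x = "(t0, s0)" and s = UNIV and g = "tangent \<gamma>"]
      has_tangent2[of s0]
    unfolding has_vector_derivative_def by simp
  have N: "((\<lambda>p. norm (X (fst p) - \<gamma> (snd p))) has_derivative (\<lambda>p. (fst p *\<^sub>R X' - snd p *\<^sub>R tangent \<gamma> s0) \<bullet> d)) (at (t0, s0))"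
    unfolding d_def
    using has_derivative_compose[OF W, where g = norm] has_derivative_norm[of "X t0 - \<gamma> s0"] ne
    by simp
  have "((\<lambda>p. ((X (fst p) - \<gamma> (snd p)) \<bullet> tangent \<gamma> (snd p)) / norm (X (fst p) - \<gamma> (snd p))) has_derivative
     (\<lambda>p. (((X t0 - \<gamma> s0) \<bullet> (snd p *\<^sub>R tangent (tangent \<gamma>) s0) + (fst p *\<^sub>R X' - snd p *\<^sub>R tangent \<gamma> s0) \<bullet> tangent \<gamma> s0) * r
        - ((X t0 - \<gamma> s0) \<bullet> tangent \<gamma> s0) * ((fst p *\<^sub>R X' - snd p *\<^sub>R tangent \<gamma> s0) \<bullet> d)) / (r * r))) (at (t0, s0))"
    using has_derivative_divide'[OF has_derivative_inner[OF W V] N] ne by (simp add: r_def)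
  moreover have "X t0 - \<gamma> s0 = r *\<^sub>R d" using r by (simp add: d_def r_def sgn_div_norm)
  then have "(((X t0 - \<gamma> s0) \<bullet> (snd p *\<^sub>R tangent (tangent \<gamma>) s0) + (fst p *\<^sub>R X' - snd p *\<^sub>R tangent \<gamma> s0) \<bullet> tangent \<gamma> s0) * r
        - ((X t0 - \<gamma> s0) \<bullet> tangent \<gamma> s0) * ((fst p *\<^sub>R X' - snd p *\<^sub>R tangent \<gamma> s0) \<bullet> d)) / (r * r)
     = (case p of (a, b) \<Rightarrow> (X' \<bullet> tangent \<gamma> s0 - (d \<bullet> tangent \<gamma> s0) * (X' \<bullet> d)) / r * a +
      (((d \<bullet> tangent \<gamma> s0)\<^sup>2 - 1) / r + d \<bullet> tangent (tangent \<gamma>) s0) * b)" for p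
    using r
    by (cases p) (simp add: inner_diff_left inner_add_left tangent_inner inner_commute[of "tangent \<gamma> s0" d]
        field_simps power2_eq_square)
  ultimately show ?thesis
    by (simp add: sgn_div_norm divide_inverse mult.commute)
qed

text \<open>The field \<open>u\<close> is the gradient of the phase, that is, the direction of the incoming rays; the
  last clause excludes that a ray reaches \<open>\<Omega>\<close> through \<open>\<Omega>'\<close> without being reflected.\<close>

definition eikonal_phase ::
    "(real^2) set \<Rightarrow> (real^2) set \<Rightarrow> (real \<Rightarrow> real^2) \<Rightarrow> (real^2 \<Rightarrow> real) \<Rightarrow> (real^2 \<Rightarrow> real^2) \<Rightarrow> bool" where
  "eikonal_phase \<Omega> \<Omega>' \<gamma>' \<Phi> u \<longleftrightarrow>
     smooth (\<lambda>t. \<Phi> (\<gamma>' t)) \<and>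
     (\<forall>y\<in>\<Omega>'. norm (u y) = 1 \<and> (\<Phi> has_derivative (\<lambda>v. u y \<bullet> v)) (at y within \<Omega>') \<and>
       (\<forall>z\<in>\<Omega>'. \<Phi> y + u y \<bullet> (z - y) \<le> \<Phi> z) \<and> (\<forall>x\<in>\<Omega>. u y \<noteq> sgn (x - y)))"

lemma inner_sgn_le_norm: "sgn v \<bullet> w \<le> norm (w :: 'a::real_inner)"
  using norm_cauchy_schwarz[of "sgn v" w] by (auto simp: norm_sgn split: if_splits)

lemma inner_sgn_self: "sgn v \<bullet> v = norm (v :: 'a::real_inner)"
  by (cases "v = 0") (simp_all add: sgn_div_norm power2_norm_eq_inner[symmetric] power2_eq_square)

locale reflection = X: obstacle \<Omega> \<gamma> L + Y: obstacle \<Omega>' \<gamma>' L'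
  for \<Omega> \<Omega>' :: "(real^2) set" and \<gamma> \<gamma>' :: "real \<Rightarrow> real^2" and L L' :: real +
  fixes \<Phi> :: "real^2 \<Rightarrow> real" and u :: "real^2 \<Rightarrow> real^2"
  assumes disjoint: "\<Omega> \<inter> \<Omega>' = {}" and eikonal: "eikonal_phase \<Omega> \<Omega>' \<gamma>' \<Phi> u"
begin

lemma
  shows smooth_phase: "smooth (\<lambda>t. \<Phi> (\<gamma>' t))"
    and unit: "y \<in> \<Omega>' \<Longrightarrow> norm (u y) = 1"
    and gradient: "y \<in> \<Omega>' \<Longrightarrow> (\<Phi> has_derivative (\<lambda>v. u y \<bullet> v)) (at y within \<Omega>')"
    and subgradient: "y \<in> \<Omega>' \<Longrightarrow> z \<in> \<Omega>' \<Longrightarrow> \<Phi> y + u y \<bullet> (z - y) \<le> \<Phi> z"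
    and nonaligned: "y \<in> \<Omega>' \<Longrightarrow> x \<in> \<Omega> \<Longrightarrow> u y \<noteq> sgn (x - y)"
  using eikonal unfolding eikonal_phase_def by blast+

lemma ne: "x \<in> \<Omega> \<Longrightarrow> y \<in> \<Omega>' \<Longrightarrow> x \<noteq> y"
  using disjoint by blast

lemma unit_sgn: "x \<in> \<Omega> \<Longrightarrow> y \<in> \<Omega>' \<Longrightarrow> norm (sgn (x - y)) = 1"
  using ne by (simp add: norm_sgn)

lemma has_derivative_combined:
  assumes "x \<in> \<Omega>" "y \<in> \<Omega>'"
  shows "(combined_phase \<Phi> x has_derivative (\<lambda>v. (u y - sgn (x - y)) \<bullet> v)) (at y within \<Omega>')"
proof -
  have "((\<lambda>y. x - y) has_derivative (\<lambda>v. - v)) (at y within \<Omega>')"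
    by (auto intro!: derivative_eq_intros)
  moreover have "x - y \<noteq> 0" using ne[OF assms] by simp
  ultimately have "((\<lambda>y. norm (x - y)) has_derivative (\<lambda>v. (- v) \<bullet> sgn (x - y))) (at y within \<Omega>')"
    by (rule has_derivative_compose[OF _ has_derivative_norm])
  from has_derivative_add[OF gradient[OF assms(2)] this] show ?thesis
    unfolding combined_phase_def[abs_def]
    by (rule has_derivative_eq_rhs) (simp add: fun_eq_iff inner_diff_left inner_commute[of _ "sgn (x - y)"])
qed

lemma has_derivative_along:
  assumes "x \<in> \<Omega>"
  shows "((\<lambda>t. combined_phase \<Phi> x (\<gamma>' t)) has_real_derivative
    (u (\<gamma>' t) - sgn (x - \<gamma>' t)) \<bullet> tangent \<gamma>' t) (at t)"
proof -
  \<comment> \<open>The gradient exists only relative to \<open>\<Omega>'\<close>; the curve never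
    leaves \<open>\<Omega>'\<close>, so the derivative within its range is enough for a two-sided
    derivative in \<open>t\<close>.\<close>
  have "(combined_phase \<Phi> x has_derivative (\<lambda>v. (u (\<gamma>' t) - sgn (x - \<gamma>' t)) \<bullet> v)) (at (\<gamma>' t) within range \<gamma>')"
    by (rule has_derivative_subset[OF has_derivative_combined[OF assms Y.in_set]]) (use Y.in_set in auto)
  from has_derivative_in_compose[OF Y.has_tangent[of t, unfolded has_vector_derivative_def] this]
  show ?thesis
    unfolding has_field_derivative_def by (rule has_derivative_eq_rhs) (simp add: fun_eq_iff)
qed

section \<open>The minimizing point, the law of reflection and visible stationary points\<close>

lemma minimizer_exists:
  assumes "x \<in> \<Omega>"
  obtains y where "y \<in> \<Omega>'" "\<And>z. z \<in> \<Omega>' \<Longrightarrow> combined_phase \<Phi> x y \<le> combined_phase \<Phi> x z"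
proof -
  have "continuous_on \<Omega>' (combined_phase \<Phi> x)"
    unfolding continuous_on_eq_continuous_within
    by (intro ballI has_derivative_continuous[OF has_derivative_combined[OF assms]])
  moreover have "\<Omega>' \<noteq> {}" using Y.in_set by blast
  ultimately show ?thesis
    using continuous_attains_inf[OF Y.compact] that by blast
qed

lemma first_order_condition:
  assumes x: "x \<in> \<Omega>" and y: "y \<in> \<Omega>'"
    and min: "\<And>z. z \<in> \<Omega>' \<Longrightarrow> combined_phase \<Phi> x y \<le> combined_phase \<Phi> x z"
    and z: "z \<in> \<Omega>'"
  shows "0 \<le> (u y - sgn (x - y)) \<bullet> (z - y)"
proof (rule ccontr)
  assume neg: "\<not> ?thesis"
  have sub: "(\<lambda>s. y + s *\<^sub>R (z - y)) ` {0..1} \<subseteq> \<Omega>'"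
    using Y.convex y z by (auto simp: convex_alt algebra_simps)
  have "((\<lambda>s. y + s *\<^sub>R (z - y)) has_derivative (\<lambda>s. s *\<^sub>R (z - y))) (at 0 within {0..1})"
    by (auto intro!: derivative_eq_intros)
  from has_derivative_in_compose[OF this, of "combined_phase \<Phi> x"]
    has_derivative_subset[OF has_derivative_combined[OF x y] sub]
  have "((\<lambda>s. combined_phase \<Phi> x (y + s *\<^sub>R (z - y))) has_derivative
      (\<lambda>s. (u y - sgn (x - y)) \<bullet> (s *\<^sub>R (z - y)))) (at 0 within {0..1})"
    unfolding scaleR_zero_left add_0_right by blast
  then have "((\<lambda>s. combined_phase \<Phi> x (y + s *\<^sub>R (z - y))) has_real_derivative
      (u y - sgn (x - y)) \<bullet> (z - y)) (at 0 within {0..1})"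
    unfolding has_field_derivative_def by (rule has_derivative_eq_rhs) (simp add: fun_eq_iff)
  from has_real_derivative_neg_dec_right[OF this] neg obtain d where "d > 0"
    "\<And>h. 0 < h \<Longrightarrow> h \<le> 1 \<Longrightarrow> h < d \<Longrightarrow> combined_phase \<Phi> x (y + h *\<^sub>R (z - y)) < combined_phase \<Phi> x y"
    by force
  from this(2)[of "min 1 (d / 2)"] this(1) have
    "combined_phase \<Phi> x (y + min 1 (d / 2) *\<^sub>R (z - y)) < combined_phase \<Phi> x y" by simp
  moreover have "y + min 1 (d / 2) *\<^sub>R (z - y) \<in> \<Omega>'"
    using \<open>d > 0\<close> by (intro subsetD[OF sub] imageI) simp
  ultimately show False using min by fastforce
qed

text \<open>Equality of angles in vector form: both directions are unit vectors, so a difference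
  along the normal means equal tangential and opposite normal components. The condition
  \<open>c > 0\<close> makes the reflected ray the outgoing one.\<close>

definition reflects :: "real^2 \<Rightarrow> real \<Rightarrow> bool" where
  "reflects x t \<longleftrightarrow> (\<exists>c>0. sgn (x - \<gamma>' t) - u (\<gamma>' t) = c *\<^sub>R Y.normal t)"

lemma minimizer_reflects:
  assumes x: "x \<in> \<Omega>" and y: "y \<in> \<Omega>'"
    and min: "\<And>z. z \<in> \<Omega>' \<Longrightarrow> combined_phase \<Phi> x y \<le> combined_phase \<Phi> x z"
  shows "y \<in> frontier \<Omega>'" and "y = \<gamma>' t \<Longrightarrow> reflects x t"
proof -
  define a where "a = sgn (x - y) - u y"
  have a: "a \<noteq> 0" using nonaligned[OF y x] by (simp add: a_def)
  have le: "a \<bullet> (z - y) \<le> 0" if "z \<in> \<Omega>'" for z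
    using first_order_condition[OF assms that] by (simp add: a_def inner_diff_left)
  show "y \<in> frontier \<Omega>'"
  proof (rule ccontr)
    assume "y \<notin> frontier \<Omega>'"
    then have "y \<in> interior \<Omega>'" using y closure_subset by (auto simp: frontier_def)
    then obtain e where e: "e > 0" "cball y e \<subseteq> \<Omega>'" by (auto simp: mem_interior_cball)
    have "y + (e / norm a) *\<^sub>R a \<in> cball y e"
      using a e(1) by (simp add: dist_norm)
    then have "a \<bullet> ((e / norm a) *\<^sub>R a) \<le> 0" using le e(2) by fastforce
    moreover have "a \<bullet> a > 0" "norm a > 0" using a by simp_all
    ultimately show False using e(1) by (simp add: mult_le_0_iff divide_le_0_iff)
  qed
  show "reflects x t" if "y = \<gamma>' t"
    using Y.supporting_normal[OF a, of t] le unfolding reflects_def a_def that by metis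
qed

text \<open>Inserting \<open>u = d - c *\<^sub>R n\<close> into the condition that \<open>u\<close>
  and \<open>d\<close> are unit vectors leaves only \<open>c = 0\<close> or
  \<open>c = 2 * (d \<bullet> n)\<close>, with \<open>d\<close> the outgoing direction and
  \<open>n\<close> the normal.\<close>

lemma reflects_inner:
  assumes "x \<in> \<Omega>" "reflects x t"
  shows "sgn (x - \<gamma>' t) \<bullet> Y.normal t > 0"
    and "u (\<gamma>' t) \<bullet> Y.normal t = - (sgn (x - \<gamma>' t) \<bullet> Y.normal t)"
    and "u (\<gamma>' t) \<bullet> tangent \<gamma>' t = sgn (x - \<gamma>' t) \<bullet> tangent \<gamma>' t"
    and "sgn (x - \<gamma>' t) - u (\<gamma>' t) = (2 * (sgn (x - \<gamma>' t) \<bullet> Y.normal t)) *\<^sub>R Y.normal t"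
proof -
  define d where "d = sgn (x - \<gamma>' t)"
  obtain c where c: "c > 0" "d - u (\<gamma>' t) = c *\<^sub>R Y.normal t"
    using assms(2) unfolding reflects_def d_def by blast
  have u: "u (\<gamma>' t) = d - c *\<^sub>R Y.normal t" using c(2) by (simp add: algebra_simps)
  have "d \<bullet> d = 1" "u (\<gamma>' t) \<bullet> u (\<gamma>' t) = 1"
    using unit_sgn[OF assms(1) Y.in_set] unit[OF Y.in_set] by (simp_all add: d_def norm_eq_1)
  then have "c * (c - 2 * (d \<bullet> Y.normal t)) = 0"
    unfolding u by (simp add: inner_diff_left inner_diff_right Y.normal_inner inner_commute algebra_simps)
  then have c2: "c = 2 * (d \<bullet> Y.normal t)" using c(1) by simp
  show "sgn (x - \<gamma>' t) \<bullet> Y.normal t > 0" using c(1) c2 by (simp add: d_def)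
  show "u (\<gamma>' t) \<bullet> Y.normal t = - (sgn (x - \<gamma>' t) \<bullet> Y.normal t)"
    unfolding u d_def[symmetric] by (simp add: inner_diff_left Y.normal_inner c2)
  show "u (\<gamma>' t) \<bullet> tangent \<gamma>' t = sgn (x - \<gamma>' t) \<bullet> tangent \<gamma>' t"
    unfolding u d_def[symmetric] by (simp add: inner_diff_left rot_right_inner)
  show "sgn (x - \<gamma>' t) - u (\<gamma>' t) = (2 * (sgn (x - \<gamma>' t) \<bullet> Y.normal t)) *\<^sub>R Y.normal t"
    using c(2) unfolding c2 d_def .
qed

text \<open>Adding the subgradient inequalities of \<open>\<Phi>\<close> and of the norm bounds the
  increase below by \<open>(u y - d) \<bullet> (z - y)\<close>, a negative multiple of
  \<open>n \<bullet> (z - y)\<close> with \<open>n\<close> the normal, hence positive by strict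
  support. Uniqueness and continuity of the reflecting point both rest on this.\<close>

lemma reflects_strict_minimum:
  assumes "x \<in> \<Omega>" "reflects x t" "z \<in> \<Omega>'" "z \<noteq> \<gamma>' t"
  shows "combined_phase \<Phi> x (\<gamma>' t) < combined_phase \<Phi> x z"
proof -
  define y d where "y = \<gamma>' t" and "d = sgn (x - y)"
  obtain c where c: "c > 0" "d - u y = c *\<^sub>R Y.normal t"
    using assms(2) unfolding reflects_def d_def y_def by blast
  have "(d - u y) \<bullet> (z - y) < 0"
    unfolding c(2) using Y.normal_supports_strictly[OF assms(3,4)] c(1) by (simp add: y_def mult_pos_neg)
  moreover have "\<Phi> y + u y \<bullet> (z - y) \<le> \<Phi> z"
    using subgradient assms(3) Y.in_set by (simp add: y_def)
  moreover have "d \<bullet> (x - z) \<le> norm (x - z)" unfolding d_def by (rule inner_sgn_le_norm)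
  moreover have "d \<bullet> (x - y) = norm (x - y)" unfolding d_def by (rule inner_sgn_self)
  ultimately show ?thesis
    unfolding combined_phase_def y_def[symmetric] by (simp add: inner_diff_left inner_diff_right)
qed

text \<open>A parameter instead of a point, so that it can be differentiated along
  \<open>\<gamma>'\<close>. Being confined to one period, it may jump when the reflecting point
  passes \<open>\<gamma>' 0\<close>.\<close>

definition bounce :: "real^2 \<Rightarrow> real" where
  "bounce x = (SOME t. t \<in> {0..<L'} \<and> reflects x t)"

lemma bounce:
  assumes "x \<in> \<Omega>"
  shows "bounce x \<in> {0..<L'}" "reflects x (bounce x)"
proof -
  obtain y where y: "y \<in> \<Omega>'" "\<And>z. z \<in> \<Omega>' \<Longrightarrow> combined_phase \<Phi> x y \<le> combined_phase \<Phi> x z"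
    using minimizer_exists[OF assms] by blast
  note f = minimizer_reflects[OF assms y]
  have "param \<gamma>' L' y \<in> {0..<L'} \<and> reflects x (param \<gamma>' L' y)"
    using Y.param[OF f(1)] f(2) by simp
  then show "bounce x \<in> {0..<L'}" "reflects x (bounce x)"
    unfolding bounce_def by (metis (mono_tags, lifting) someI)+
qed

lemmas bounce_inner = reflects_inner[OF _ bounce(2)]

lemma param_bounce: "x \<in> \<Omega> \<Longrightarrow> param \<gamma>' L' (\<gamma>' (bounce x)) = bounce x"
  unfolding param_def using the_inv_into_f_f[OF Y.inj] bounce(1) by blast

text \<open>The segment without its endpoint on the obstacle is connected, misses the frontier and
  contains \<open>x\<close> outside \<open>\<Omega>'\<close>, so it misses \<open>\<Omega>'\<close>.
  A line separating the two convex sets must pass through that endpoint, hence is the tangent line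
  there.\<close>

lemma not_past_obstacle:
  assumes "x \<in> \<Omega>" "closed_segment x (\<gamma>' t) \<inter> frontier \<Omega>' = {\<gamma>' t}"
  shows "sgn (x - \<gamma>' t) \<bullet> Y.normal t \<ge> 0"
proof -
  define y S where "y = \<gamma>' t" and "S = open_segment y x \<union> {x}"
  have xy: "x \<noteq> y" using ne[OF assms(1) Y.in_set] by (simp add: y_def)
  have x: "x \<notin> \<Omega>'" using disjoint assms(1) by blast
  have S: "S = (\<lambda>s. y + s *\<^sub>R (x - y)) ` {0<..1}"
  proof -
    have "{0<..1::real} = {0<..<1} \<union> {1}" by auto
    then show ?thesis
      unfolding S_def open_segment_image_interval using xy
      by (simp add: image_Un image_insert algebra_simps)
  qed
  have "convex ((+) y ` (\<lambda>s. s *\<^sub>R (x - y)) ` {0<..1})"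
    by (intro convex_translation convex_linear_image linearI convex_real_interval)
      (simp_all add: algebra_simps)
  then have "convex S" unfolding S by (simp add: image_image)
  have "S \<inter> frontier \<Omega>' = {}"
    using assms(2) xy unfolding S_def y_def[symmetric]
    by (auto simp: open_segment_def closed_segment_commute)
  with \<open>convex S\<close> have "S \<inter> \<Omega>' = {}"
    using connected_Int_frontier[of S \<Omega>'] convex_connected x unfolding S_def by blast
  moreover have "S \<noteq> {}" "\<Omega>' \<noteq> {}" unfolding S_def using Y.in_set by auto
  ultimately obtain a b where ab: "a \<noteq> 0" "\<And>z. z \<in> \<Omega>' \<Longrightarrow> a \<bullet> z \<le> b" "\<And>z. z \<in> S \<Longrightarrow> b \<le> a \<bullet> z"
    using separating_hyperplane_sets[OF Y.convex \<open>convex S\<close>] by blast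
  \<comment> \<open>The point \<open>y\<close> is a limit of points of \<open>S\<close>, so it
    satisfies both separating inequalities and lies on the separating line.\<close>
  have "((\<lambda>s. a \<bullet> (y + s *\<^sub>R (x - y))) \<longlongrightarrow> a \<bullet> (y + 0 *\<^sub>R (x - y))) (at_right 0)"
    by (intro tendsto_intros)
  moreover have "eventually (\<lambda>s. b \<le> a \<bullet> (y + s *\<^sub>R (x - y))) (at_right (0::real))"
    unfolding eventually_at_right_field using ab(3)[unfolded S, OF imageI]
    by (intro exI[of _ 1]) simp
  ultimately have "b \<le> a \<bullet> (y + 0 *\<^sub>R (x - y))"
    by (rule tendsto_lowerbound) simp
  then have b: "a \<bullet> y = b" using ab(2)[of y] Y.in_set by (force simp: y_def)
  obtain c where c: "c > 0" "a = c *\<^sub>R Y.normal t"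
  proof (rule Y.supporting_normal[OF ab(1), of t])
    show "a \<bullet> (z - \<gamma>' t) \<le> 0" if "z \<in> \<Omega>'" for z
      using ab(2)[OF that] b by (simp add: y_def inner_diff_right)
  qed
  have "a \<bullet> (x - y) \<ge> 0" using ab(3)[of x] b by (simp add: S_def inner_diff_right)
  then have "Y.normal t \<bullet> (x - y) \<ge> 0" unfolding c(2) using c(1) by (simp add: zero_le_mult_iff)
  then show ?thesis
    unfolding y_def[symmetric] by (simp add: sgn_div_norm inner_commute zero_le_mult_iff zero_le_divide_iff)
qed

text \<open>Stationarity only equates the tangential components of the two unit vectors, so the
  normal ones agree up to sign. Equal signs mean a ray that passes on undeflected, excluded by
  \<open>nonaligned\<close>; opposite signs with the target behind the tangent line are excluded by
  visibility. Only the law of reflection remains, and the strict minimum makes its solution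
  unique.\<close>

lemma visible_stationary_iff:
  assumes x: "x \<in> \<Omega>"
  shows "visible_stationary \<gamma>' L' \<Phi> x y \<longleftrightarrow> y = \<gamma>' (bounce x)"
proof
  assume vs: "visible_stationary \<gamma>' L' \<Phi> x y"
  define t where "t = param \<gamma>' L' y"
  have y: "y \<in> frontier \<Omega>'" "((\<lambda>t. combined_phase \<Phi> x (\<gamma>' t)) has_real_derivative 0) (at t)"
    "closed_segment x y \<inter> frontier \<Omega>' = {y}"
    using vs Y.image unfolding visible_stationary_def t_def by auto
  have yt: "y = \<gamma>' t" using Y.param[OF y(1)] by (simp add: t_def)
  define d where "d = sgn (x - y)"
  have "(d - u y) \<bullet> tangent \<gamma>' t = 0"
    using DERIV_unique[OF y(2) has_derivative_along[OF x]] by (simp add: yt d_def inner_diff_left)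
  then have c: "d - u y = ((d - u y) \<bullet> Y.normal t) *\<^sub>R Y.normal t"
    using frame_decomp[OF Y.norm_tangent[of t], of "d - u y"] by simp
  have nn: "d \<bullet> Y.normal t \<ge> 0" using not_past_obstacle[OF x] y(3) unfolding yt d_def by blast
  have tu: "u y \<bullet> tangent \<gamma>' t = d \<bullet> tangent \<gamma>' t"
    using \<open>(d - u y) \<bullet> tangent \<gamma>' t = 0\<close> by (simp add: inner_diff_left)
  have "y \<in> \<Omega>'" using y(1) Y.frontier_subset by blast
  then have "d \<bullet> d = 1" "u y \<bullet> u y = 1"
    using unit_sgn[OF x] unit by (simp_all add: d_def norm_eq_1)
  then have "(u y \<bullet> Y.normal t)\<^sup>2 = (d \<bullet> Y.normal t)\<^sup>2"
    using frame_inner[OF Y.norm_tangent[of t], of d d] frame_inner[OF Y.norm_tangent[of t], of "u y" "u y"] tu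
    by (simp add: power2_eq_square)
  then have "u y \<bullet> Y.normal t = d \<bullet> Y.normal t \<or> u y \<bullet> Y.normal t = - (d \<bullet> Y.normal t)"
    by (simp add: power2_eq_iff)
  moreover have "(d - u y) \<bullet> Y.normal t \<noteq> 0"
  proof
    assume "(d - u y) \<bullet> Y.normal t = 0"
    then have "d = u y" using c by simp
    then show False using nonaligned[OF \<open>y \<in> \<Omega>'\<close> x] by (simp add: d_def)
  qed
  ultimately have "(d - u y) \<bullet> Y.normal t > 0" using nn by (auto simp: inner_diff_left)
  then have "reflects x t" unfolding reflects_def using c by (auto simp: yt d_def)
  then show "y = \<gamma>' (bounce x)"
    using reflects_strict_minimum[OF x _ Y.in_set] bounce(2)[OF x] less_asym unfolding yt by metis
next
  assume yb: "y = \<gamma>' (bounce x)"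
  define t where "t = bounce x"
  have yt: "y = \<gamma>' t" using yb by (simp add: t_def)
  note r = bounce_inner[OF x x, folded t_def]
  have "((\<lambda>t. combined_phase \<Phi> x (\<gamma>' t)) has_real_derivative 0) (at t)"
    using has_derivative_along[OF x, of t] r(3) by (simp add: inner_diff_left)
  moreover have "closed_segment x y \<inter> frontier \<Omega>' = {y}"
  proof -
    have "z = y" if z: "z \<in> closed_segment x y" "z \<in> \<Omega>'" for z
    proof (rule ccontr)
      assume "z \<noteq> y"
      obtain s where s: "0 \<le> s" "z = y + s *\<^sub>R (x - y)"
        using z(1) unfolding closed_segment_commute[of x] by (auto simp: closed_segment_def algebra_simps)
      have "x - y = norm (x - y) *\<^sub>R sgn (x - y)" using ne[OF x Y.in_set, of t] by (simp add: sgn_div_norm yt)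
      then have "Y.normal t \<bullet> (z - y) = s * (norm (x - y) * (sgn (x - y) \<bullet> Y.normal t))"
        using s(2) by (metis add_diff_cancel_left' inner_commute inner_scaleR_right)
      also have "\<dots> \<ge> 0" using s(1) r(1) by (simp add: yt)
      finally show False using Y.normal_supports_strictly[OF z(2), of t] \<open>z \<noteq> y\<close> by (simp add: yt)
    qed
    then show ?thesis using Y.in_frontier Y.frontier_subset by (auto simp: yt)
  qed
  ultimately show "visible_stationary \<gamma>' L' \<Phi> x y"
    unfolding visible_stationary_def Y.image using param_bounce[OF x] Y.in_frontier by (simp add: yt t_def)
qed

end

lemma combined_phase_lipschitz: "combined_phase \<phi> x z \<le> combined_phase \<phi> x' z + norm (x - x')"
  using norm_triangle_ineq[of "x' - z" "x - x'"] by (simp add: combined_phase_def norm_minus_commute)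

section \<open>Hessian of the combined phase, convexity and gradient of the transformed
  phase\<close>

context reflection
begin

lemma has_derivative_phase_along:
  "((\<lambda>t. \<Phi> (\<gamma>' t)) has_vector_derivative u (\<gamma>' t) \<bullet> tangent \<gamma>' t) (at t)"
proof -
  have "(\<Phi> has_derivative (\<lambda>v. u (\<gamma>' t) \<bullet> v)) (at (\<gamma>' t) within range \<gamma>')"
    by (rule has_derivative_subset[OF gradient[OF Y.in_set]]) (use Y.in_set in auto)
  from has_derivative_in_compose[OF Y.has_tangent[of t, unfolded has_vector_derivative_def] this]
  show ?thesis
    unfolding has_vector_derivative_def by (rule has_derivative_eq_rhs) (simp add: fun_eq_iff)
qed

abbreviation phase_deriv :: "real \<Rightarrow> real" where
  "phase_deriv t \<equiv> u (\<gamma>' t) \<bullet> tangent \<gamma>' t"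

abbreviation phase_deriv2 :: "real \<Rightarrow> real" where
  "phase_deriv2 t \<equiv> vector_derivative phase_deriv (at t)"

text \<open>The field \<open>u\<close> is not assumed smooth; its tangential component is smooth
  because it is the derivative of the phase along the curve.\<close>

lemma smooth_phase_deriv: "smooth phase_deriv"
  using smooth_derivative[OF smooth_phase]
  unfolding vector_derivative_at[OF has_derivative_phase_along] .

lemma has_phase_deriv2: "(phase_deriv has_vector_derivative phase_deriv2 t) (at t)"
  by (rule smooth_has_derivative[OF smooth_phase_deriv])

lemma phase_deriv_periodic: "phase_deriv (t + L') = phase_deriv t"
  by (simp only: Y.periodic Y.tangent_periodic)

text \<open>The three terms come from the incoming phase, from the circular wave centred at
  \<open>x\<close>, and from the bending of the boundary.\<close>

definition hessian :: "real^2 \<Rightarrow> real \<Rightarrow> real" where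
  "hessian x t = phase_deriv2 t + (1 - (sgn (x - \<gamma>' t) \<bullet> tangent \<gamma>' t)\<^sup>2) / norm (x - \<gamma>' t)
     - sgn (x - \<gamma>' t) \<bullet> tangent (tangent \<gamma>') t"

text \<open>One derivative in two variables for two purposes: constant \<open>X\<close> gives the
  second derivative of the combined phase, and \<open>X = \<gamma>\<close> allows implicit
  differentiation of the reflecting point.\<close>

lemma has_derivative_stationarity:
  fixes s0 :: real
  assumes "(X has_vector_derivative X') (at t0)" "X t0 \<in> \<Omega>"
  defines "d \<equiv> sgn (X t0 - \<gamma>' s0)"
  shows "((\<lambda>p. (u (\<gamma>' (snd p)) - sgn (X (fst p) - \<gamma>' (snd p))) \<bullet> tangent \<gamma>' (snd p)) has_derivative
    (\<lambda>(a, b). - ((X' \<bullet> tangent \<gamma>' s0 - (d \<bullet> tangent \<gamma>' s0) * (X' \<bullet> d)) / norm (X t0 - \<gamma>' s0)) * a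
      + hessian (X t0) s0 * b)) (at (t0, s0))"
proof -
  have "X t0 \<noteq> \<gamma>' s0" using ne[OF assms(2) Y.in_set] .
  note * = Y.has_derivative_projection[OF assms(1) this, folded d_def]
  have "((\<lambda>p. phase_deriv (snd p)) has_derivative (\<lambda>p. snd p * phase_deriv2 s0)) (at (t0, s0))"
    using has_derivative_compose[OF has_derivative_snd[OF has_derivative_ident], where x = "(t0, s0)" and s = UNIV and g = phase_deriv]
      has_phase_deriv2[of s0]
    unfolding has_vector_derivative_def by simp
  from has_derivative_diff[OF this *]
  have "((\<lambda>p. (u (\<gamma>' (snd p)) - sgn (X (fst p) - \<gamma>' (snd p))) \<bullet> tangent \<gamma>' (snd p)) has_derivative
    (\<lambda>p. snd p * phase_deriv2 s0 - (case p of (a, b) \<Rightarrow>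
      (X' \<bullet> tangent \<gamma>' s0 - (d \<bullet> tangent \<gamma>' s0) * (X' \<bullet> d)) / norm (X t0 - \<gamma>' s0) * a +
      (((d \<bullet> tangent \<gamma>' s0)\<^sup>2 - 1) / norm (X t0 - \<gamma>' s0) + d \<bullet> tangent (tangent \<gamma>') s0) * b))) (at (t0, s0))"
    by (simp only: inner_diff_left)
  then show ?thesis
    by (rule has_derivative_eq_rhs)
      (auto simp: fun_eq_iff hessian_def d_def diff_divide_distrib algebra_simps)
qed

lemma has_derivative_along2:
  assumes "x \<in> \<Omega>"
  shows "((\<lambda>t. (u (\<gamma>' t) - sgn (x - \<gamma>' t)) \<bullet> tangent \<gamma>' t) has_real_derivative hessian x t) (at t)"
proof -
  have "((\<lambda>t::real. (0::real, t)) has_derivative (\<lambda>h. (0, h))) (at t)"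
    by (auto intro!: derivative_eq_intros)
  from has_derivative_compose[OF this has_derivative_stationarity[of "\<lambda>_. x" 0 0 t]] assms
  show ?thesis
    unfolding has_field_derivative_def by (simp add: has_vector_derivative_const)
qed

lemma phase_hessian_eq:
  assumes "x \<in> \<Omega>"
  shows "phase_hessian \<gamma>' L' \<Phi> x (\<gamma>' (bounce x)) = hessian x (bounce x)"
proof -
  have "deriv (\<lambda>t. combined_phase \<Phi> x (\<gamma>' t)) = (\<lambda>t. (u (\<gamma>' t) - sgn (x - \<gamma>' t)) \<bullet> tangent \<gamma>' t)"
    by (rule ext, rule DERIV_imp_deriv, rule has_derivative_along[OF assms])
  moreover have "deriv (\<lambda>t. (u (\<gamma>' t) - sgn (x - \<gamma>' t)) \<bullet> tangent \<gamma>' t) t = hessian x t" for t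
    by (rule DERIV_imp_deriv, rule has_derivative_along2[OF assms])
  ultimately show ?thesis
    unfolding phase_hessian_def param_bounce[OF assms] by (simp add: numeral_2_eq_2)
qed

text \<open>Convexity of the phase: \<open>\<Phi> - u (\<gamma>' t) \<bullet> _\<close> is minimal at \<open>\<gamma>' t\<close>.\<close>

lemma phase_deriv2_ge: "phase_deriv2 t \<ge> - curvature \<gamma>' t * (u (\<gamma>' t) \<bullet> Y.normal t)"
proof -
  define w where "w = u (\<gamma>' t)"
  have "((\<lambda>s. \<Phi> (\<gamma>' s) - w \<bullet> \<gamma>' s) has_real_derivative phase_deriv s - w \<bullet> tangent \<gamma>' s) (at s)" for s
    unfolding has_real_derivative_iff_has_vector_derivative
    by (intro has_vector_derivative_diff has_derivative_phase_along
        bounded_linear.has_vector_derivative[OF bounded_linear_inner_right] Y.has_tangent)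
  moreover have "((\<lambda>s. phase_deriv s - w \<bullet> tangent \<gamma>' s) has_real_derivative
      phase_deriv2 t - w \<bullet> tangent (tangent \<gamma>') t) (at t)"
    unfolding has_real_derivative_iff_has_vector_derivative
    by (intro has_vector_derivative_diff has_phase_deriv2
        bounded_linear.has_vector_derivative[OF bounded_linear_inner_right] Y.has_tangent2)
  moreover have "\<Phi> (\<gamma>' t) - w \<bullet> \<gamma>' t \<le> \<Phi> (\<gamma>' s) - w \<bullet> \<gamma>' s" for s
    using subgradient[OF Y.in_set Y.in_set, of t s] by (simp add: w_def inner_diff_right)
  ultimately have "0 \<le> phase_deriv2 t - w \<bullet> tangent (tangent \<gamma>') t"
    by (rule DERIV_second_nonneg_at_min)
  then show ?thesis by (simp add: Y.tangent2 w_def)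
qed

text \<open>The curvature counts twice: once through the bending of the boundary in the distance
  term, and once through the convexity bound on the phase, where the law of reflection turns
  \<open>- u \<bullet> n\<close> into \<open>c\<close>.\<close>

lemma hessian_ge:
  assumes x: "x \<in> \<Omega>" and "reflects x t"
  defines "c \<equiv> sgn (x - \<gamma>' t) \<bullet> Y.normal t"
  shows "hessian x t \<ge> c\<^sup>2 / norm (x - \<gamma>' t) + 2 * curvature \<gamma>' t * c"
proof -
  have "1 - (sgn (x - \<gamma>' t) \<bullet> tangent \<gamma>' t)\<^sup>2 = c\<^sup>2"
    using frame_inner[OF Y.norm_tangent[of t], of "sgn (x - \<gamma>' t)" "sgn (x - \<gamma>' t)"]
      unit_sgn[OF x Y.in_set, of t]
    by (simp add: c_def norm_eq_1 power2_eq_square)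
  then show ?thesis
    using phase_deriv2_ge[of t] reflects_inner(2)[OF assms(1,2)]
    unfolding hessian_def Y.tangent2 by (simp add: c_def)
qed

lemma hessian_pos:
  assumes "x \<in> \<Omega>" "reflects x t"
  shows "hessian x t > 0"
proof -
  have "2 * curvature \<gamma>' t * (sgn (x - \<gamma>' t) \<bullet> Y.normal t) > 0"
    using Y.curvature_pos reflects_inner(1)[OF assms] by simp
  then show ?thesis using hessian_ge[OF assms] by (smt (verit) divide_nonneg_nonneg norm_ge_zero zero_le_power2)
qed

definition new_phase :: "real^2 \<Rightarrow> real" where
  "new_phase x = combined_phase \<Phi> x (\<gamma>' (bounce x))"

definition new_direction :: "real^2 \<Rightarrow> real^2" where
  "new_direction x = sgn (x - \<gamma>' (bounce x))"

lemma new_phase_le: "x \<in> \<Omega> \<Longrightarrow> z \<in> \<Omega>' \<Longrightarrow> new_phase x \<le> combined_phase \<Phi> x z"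
  using reflects_strict_minimum[OF _ bounce(2)] unfolding new_phase_def by force

text \<open>With \<open>y\<close> and \<open>y'\<close> the reflecting points of \<open>x\<close>
  and \<open>x'\<close>, the subgradient inequality of \<open>\<Phi>\<close> from \<open>y\<close>
  to \<open>y'\<close> and that of the norm at \<open>x - y\<close> add up. The mismatch
  \<open>(d - u y) \<bullet> (y' - y)\<close> has the right sign because the normal supports
  \<open>\<Omega>'\<close>.\<close>

lemma new_phase_subgradient:
  assumes x: "x \<in> \<Omega>" and x': "x' \<in> \<Omega>"
  shows "new_phase x + new_direction x \<bullet> (x' - x) \<le> new_phase x'"
proof -
  define t where "t = bounce x"
  define y y' where "y = \<gamma>' t" and "y' = \<gamma>' (bounce x')"
  define d where "d = sgn (x - y)"
  obtain c where c: "c > 0" "d - u y = c *\<^sub>R Y.normal t"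
    using bounce(2)[OF x] unfolding reflects_def d_def y_def t_def by blast
  have "(d - u y) \<bullet> (y' - y) \<le> 0"
    unfolding c(2) using Y.normal_supports[OF Y.in_set, of t] c(1)
    by (simp add: y_def y'_def mult_le_0_iff)
  moreover have "\<Phi> y + u y \<bullet> (y' - y) \<le> \<Phi> y'"
    using subgradient Y.in_set by (simp add: y_def y'_def)
  moreover have "d \<bullet> (x' - y') \<le> norm (x' - y')" unfolding d_def by (rule inner_sgn_le_norm)
  moreover have "d \<bullet> (x - y) = norm (x - y)" unfolding d_def by (rule inner_sgn_self)
  ultimately show ?thesis
    unfolding new_phase_def new_direction_def combined_phase_def t_def[symmetric]
      y_def[symmetric] y'_def[symmetric] d_def[symmetric]
    by (simp add: inner_diff_left inner_diff_right)
qed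

lemma new_phase_gradient:
  assumes x: "x \<in> \<Omega>"
  shows "(new_phase has_derivative (\<lambda>v. new_direction x \<bullet> v)) (at x within \<Omega>)"
proof -
  define y where "y = \<gamma>' (bounce x)"
  have y: "y \<in> \<Omega>'" by (simp add: y_def Y.in_set)
  have d: "new_direction x = sgn (x - y)" by (simp add: new_direction_def y_def)
  have "((\<lambda>x. x - y) has_derivative (\<lambda>v. v)) (at x within \<Omega>)"
    by (auto intro!: derivative_eq_intros)
  moreover have "x - y \<noteq> 0" using ne[OF x y] by simp
  ultimately have "((\<lambda>x. norm (x - y)) has_derivative (\<lambda>v. v \<bullet> sgn (x - y))) (at x within \<Omega>)"
    by (rule has_derivative_compose[OF _ has_derivative_norm])
  then have lim: "((\<lambda>z. norm (norm (z - y) - norm (x - y) - (z - x) \<bullet> sgn (x - y)) / norm (z - x)) \<longlongrightarrow> 0) (at x within \<Omega>)"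
    by (simp add: has_derivative_iff_norm)
  show ?thesis
  proof (rule has_derivativeI_sandwich[OF zero_less_one bounded_linear_inner_right _ lim])
    fix z assume z: "z \<in> \<Omega>"
    have "new_phase z - new_phase x \<le> norm (z - y) - norm (x - y)"
      using new_phase_le[OF z y] by (simp add: new_phase_def combined_phase_def y_def)
    moreover have "0 \<le> new_phase z - new_phase x - new_direction x \<bullet> (z - x)"
      using new_phase_subgradient[OF x z] by simp
    ultimately show "norm (new_phase z - new_phase x - new_direction x \<bullet> (z - x)) / norm (z - x)
        \<le> norm (norm (z - y) - norm (x - y) - (z - x) \<bullet> sgn (x - y)) / norm (z - x)"
      unfolding d by (intro divide_right_mono) (simp_all add: inner_commute)
  qed
qed

lemma new_direction_nonaligned:
  assumes x: "x \<in> \<Omega>" and z: "z \<in> \<Omega>'"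
  shows "new_direction x \<noteq> sgn (z - x)"
proof
  define y where "y = \<gamma>' (bounce x)"
  assume "new_direction x = sgn (z - x)"
  then have eq: "sgn (x - y) = sgn (z - x)" by (simp add: new_direction_def y_def)
  have y: "y \<in> \<Omega>'" by (simp add: y_def Y.in_set)
  define a b where "a = norm (x - y)" and "b = norm (z - x)"
  have ab: "a > 0" "b > 0" using ne[OF x y] ne[OF x z] by (simp_all add: a_def b_def)
  have "x - y = a *\<^sub>R sgn (z - x)" unfolding eq[symmetric] a_def using ne[OF x y] by (simp add: sgn_div_norm)
  moreover have "z - x = b *\<^sub>R sgn (z - x)" unfolding b_def using ne[OF x z] by (simp add: sgn_div_norm)
  ultimately have "b *\<^sub>R (x - y) = a *\<^sub>R (z - x)" by (metis mult.commute scaleR_scaleR)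
  then have "(a + b) *\<^sub>R x = b *\<^sub>R y + a *\<^sub>R z" by (simp add: algebra_simps)
  then have "x = (b / (a + b)) *\<^sub>R y + (a / (a + b)) *\<^sub>R z"
  proof -
    have "x = (1 / (a + b)) *\<^sub>R ((a + b) *\<^sub>R x)" using ab by simp
    then show ?thesis
      unfolding \<open>(a + b) *\<^sub>R x = b *\<^sub>R y + a *\<^sub>R z\<close> by (simp add: scaleR_add_right)
  qed
  moreover have "(b / (a + b)) *\<^sub>R y + (a / (a + b)) *\<^sub>R z \<in> \<Omega>'"
    using ab by (intro convexD[OF Y.convex y z]) (simp_all add: add_divide_distrib[symmetric])
  ultimately show False using disjoint x by auto
qed

section \<open>Smooth dependence of the reflecting point on the target\<close>

definition bounce_speed :: "real \<Rightarrow> real" where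
  "bounce_speed t = (let s = bounce (\<gamma> t); d = new_direction (\<gamma> t) in
     (tangent \<gamma> t \<bullet> tangent \<gamma>' s - (d \<bullet> tangent \<gamma>' s) * (tangent \<gamma> t \<bullet> d)) / norm (\<gamma> t - \<gamma>' s)
       / hessian (\<gamma> t) s)"

text \<open>A periodic \<open>b\<close> does not notice which parameter represents the reflecting
  point, so \<open>bounce\<close> may be replaced by a choice \<open>s\<close> of parameters that is
  continuous at \<open>t0\<close>; implicit differentiation applies to \<open>s\<close>.\<close>

lemma bounce_has_derivative:
  assumes b: "smooth b" "\<And>t. b (t + L') = b t"
  shows "((\<lambda>t. b (bounce (\<gamma> t))) has_real_derivative
    vector_derivative b (at (bounce (\<gamma> t0))) * bounce_speed t0) (at t0)"
proof -
  define \<tau> where "\<tau> = bounce (\<gamma> t0)"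
  \<comment> \<open>A closed window of one period centred at \<open>\<tau>\<close>: every point of
    the curve has a parameter in it, and the ambiguity of the two endpoints does not affect the
    centre.\<close>
  define K where "K = {\<tau> - L' / 2 .. \<tau> + L' / 2}"
  have ex: "\<exists>s\<in>K. \<gamma>' s = \<gamma>' r" for r
  proof -
    obtain n where "(r - \<tau> + L' / 2) + of_int n * L' \<in> {0..<L'}" using Y.reduce_param by blast
    then have "r + of_int n * L' \<in> K" by (simp add: K_def)
    then show ?thesis using periodic_int_multiple[of \<gamma>', OF Y.periodic] by blast
  qed
  then have "\<exists>s. \<forall>t. s t \<in> K \<and> \<gamma>' (s t) = \<gamma>' (bounce (\<gamma> t))" by (intro choice) blast
  then obtain s where s: "\<And>t. s t \<in> K" "\<And>t. \<gamma>' (s t) = \<gamma>' (bounce (\<gamma> t))" by blast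
  have unique: "r = \<tau>" if r: "r \<in> K" "\<gamma>' r = \<gamma>' \<tau>" for r
  proof -
    obtain n where n: "r = \<tau> + of_int n * L'" using Y.same_point[OF r(2)] .
    with r(1) have "\<bar>of_int n * L'\<bar> \<le> L' / 2" by (auto simp: K_def)
    then have "\<bar>of_int n\<bar> * L' \<le> (1/2) * L'" using Y.L_pos by (simp add: abs_mult)
    then have "\<bar>of_int n\<bar> \<le> (1/2::real)" using Y.L_pos by (simp only: mult_le_cancel_right_pos)
    then have "n = 0" by linarith
    then show ?thesis using n by simp
  qed
  have s0: "s t0 = \<tau>" using unique s by (simp add: \<tau>_def)
  have "isCont s t0"
    unfolding continuous_at_eps_delta
  proof (intro allI impI)
    fix e :: real assume "e > 0"
    define f where "f r = combined_phase \<Phi> (\<gamma> t0) (\<gamma>' r)" for r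
    define C where "C = K - ball \<tau> e"
    \<comment> \<open>Outside the \<open>e\<close>-ball the strict minimum leaves a gap
      \<open>\<delta>\<close> by compactness. Moving the target by less than
      \<open>\<delta> / 2\<close> changes the phase by less than that amount; two such changes
      cannot bridge the gap.\<close>
    have "\<exists>\<delta>>0. \<forall>r\<in>C. f \<tau> + \<delta> \<le> f r"
    proof (cases "C = {}")
      case False
      have "compact C" unfolding C_def K_def by (intro compact_diff) auto
      moreover have "continuous_on C f"
        unfolding f_def[abs_def]
        by (rule DERIV_continuous_on, rule DERIV_subset[OF has_derivative_along[OF X.in_set]], simp)
      ultimately obtain r where r: "r \<in> C" "\<And>r'. r' \<in> C \<Longrightarrow> f r \<le> f r'"
        using continuous_attains_inf[OF _ False] by blast
      have "r \<noteq> \<tau>" "r \<in> K" using r(1) \<open>e > 0\<close> by (auto simp: C_def)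
      then have "f \<tau> < f r"
        unfolding f_def \<tau>_def using unique
        by (intro reflects_strict_minimum X.in_set bounce(2) Y.in_set) (auto simp: \<tau>_def)
      then show ?thesis using r(2) by (intro exI[of _ "f r - f \<tau>"]) auto
    qed (auto intro: exI[of _ 1])
    then obtain \<delta> where \<delta>: "\<delta> > 0" "\<And>r. r \<in> C \<Longrightarrow> f \<tau> + \<delta> \<le> f r" by blast
    have "isCont \<gamma> t0" using X.has_tangent has_vector_derivative_continuous by blast
    then obtain \<eta> where \<eta>: "\<eta> > 0" "\<And>t. dist t t0 < \<eta> \<Longrightarrow> dist (\<gamma> t) (\<gamma> t0) < \<delta> / 2"
      using \<delta>(1) unfolding continuous_at_eps_delta by (metis half_gt_zero)
    have "dist (s t) (s t0) < e" if "dist t t0 < \<eta>" for t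
    proof -
      have "f (s t) \<le> new_phase (\<gamma> t) + norm (\<gamma> t0 - \<gamma> t)"
        unfolding f_def new_phase_def s(2) by (rule combined_phase_lipschitz)
      also have "new_phase (\<gamma> t) \<le> combined_phase \<Phi> (\<gamma> t) (\<gamma>' \<tau>)"
        by (intro new_phase_le X.in_set Y.in_set)
      also have "\<dots> \<le> f \<tau> + norm (\<gamma> t - \<gamma> t0)"
        unfolding f_def by (rule combined_phase_lipschitz)
      finally have "f (s t) < f \<tau> + \<delta>"
        using \<eta>(2)[OF that] by (simp add: dist_norm norm_minus_commute)
      then have "s t \<notin> C" using \<delta>(2)[of "s t"] by linarith
      then show ?thesis using s(1)[of t] by (simp add: C_def s0 dist_commute)
    qed
    then show "\<exists>d>0. \<forall>x'. dist x' t0 < d \<longrightarrow> dist (s x') (s t0) < e" using \<eta>(1) by blast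
  qed
  have zero: "(u (\<gamma>' (s t)) - sgn (\<gamma> t - \<gamma>' (s t))) \<bullet> tangent \<gamma>' (s t) = 0" for t
  proof -
    have "tangent \<gamma>' (s t) = tangent \<gamma>' (bounce (\<gamma> t))"
      by (rule Y.periodic_same_point[OF s(2), of "tangent \<gamma>'", OF Y.tangent_periodic])
    then show ?thesis
      unfolding s(2) using bounce_inner(3)[OF X.in_set X.in_set] by (simp add: inner_diff_left)
  qed
  \<comment> \<open>The value \<open>bounce_speed\<close> is the quotient \<open>- (A / B)\<close>
    of the implicit derivative, with \<open>B\<close> the Hessian, which is positive at a reflecting
    point.\<close>
  have "(s has_real_derivative bounce_speed t0) (at t0)"
    using implicit_has_real_derivative[OF has_derivative_stationarity[OF X.has_tangent X.in_set, of t0 "s t0"]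
        _ _ \<open>isCont s t0\<close>] zero hessian_pos[OF X.in_set bounce(2)[OF X.in_set], of t0]
    unfolding s0 by (simp add: bounce_speed_def Let_def new_direction_def \<tau>_def)
  moreover have "(b has_real_derivative vector_derivative b (at (s t0))) (at (s t0))"
    unfolding has_real_derivative_iff_has_vector_derivative by (rule smooth_has_derivative[OF b(1)])
  ultimately have "((\<lambda>t. b (s t)) has_real_derivative vector_derivative b (at (s t0)) * bounce_speed t0) (at t0)"
    by (rule DERIV_chain2[rotated])
  moreover have "b (s t) = b (bounce (\<gamma> t))" for t
    by (rule Y.periodic_same_point[OF s(2), of b, OF b(2)])
  ultimately show ?thesis by (simp add: s0 \<tau>_def)
qed

abbreviation bounce_algebra :: "(real \<Rightarrow> real) set" where
  "bounce_algebra \<equiv> smooth_algebra (\<lambda>t. bounce (\<gamma> t)) L'"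

lemma inner_in_algebra:
  assumes "\<And>i. (\<lambda>t. (f t :: real^2) $ i) \<in> bounce_algebra" "\<And>i. (\<lambda>t. (g t :: real^2) $ i) \<in> bounce_algebra"
  shows "(\<lambda>t. f t \<bullet> g t) \<in> bounce_algebra"
  unfolding inner_2 by (intro smooth_algebra.add smooth_algebra.mult assms)

lemma smooth_nth_in_algebra:
  assumes "smooth f"
  shows "(\<lambda>t. (f t :: real^2) $ i) \<in> bounce_algebra"
  by (rule smooth_algebra.smooth[OF smooth_nth[OF assms]])

lemma periodic_nth_in_algebra:
  assumes "smooth f" "\<And>t. f (t + L') = f t"
  shows "(\<lambda>t. (f (bounce (\<gamma> t)) :: real^2) $ i) \<in> bounce_algebra"
  using smooth_algebra.periodic[OF smooth_nth[OF assms(1)], of L'] by (simp add: assms(2))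

lemma difference_in_algebra: "(\<lambda>t. (\<gamma> t - \<gamma>' (bounce (\<gamma> t))) $ i) \<in> bounce_algebra"
  unfolding vector_minus_component
  by (intro smooth_algebra_diff smooth_nth_in_algebra X.smooth periodic_nth_in_algebra Y.smooth Y.periodic)

lemma distance_in_algebra: "(\<lambda>t. norm (\<gamma> t - \<gamma>' (bounce (\<gamma> t)))) \<in> bounce_algebra"
  unfolding norm_eq_sqrt_inner
  by (intro smooth_algebra.sqrt inner_in_algebra difference_in_algebra)
    (simp add: ne[OF X.in_set Y.in_set])

lemma new_direction_in_algebra: "(\<lambda>t. new_direction (\<gamma> t) $ i) \<in> bounce_algebra"
proof -
  have "(\<lambda>t. (\<gamma> t - \<gamma>' (bounce (\<gamma> t))) $ i / norm (\<gamma> t - \<gamma>' (bounce (\<gamma> t)))) \<in> bounce_algebra"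
    by (intro smooth_algebra_divide difference_in_algebra distance_in_algebra)
      (simp add: ne[OF X.in_set Y.in_set])
  then show ?thesis by (simp add: new_direction_def sgn_div_norm divide_inverse mult.commute)
qed

text \<open>This closes the bootstrap: the speed is built from smooth functions of \<open>t\<close>
  and periodic functions of the reflecting parameter, with the nonvanishing distance and Hessian as
  denominators.\<close>

lemma bounce_speed_in_algebra: "bounce_speed \<in> bounce_algebra"
proof -
  have T: "(\<lambda>t. tangent \<gamma>' (bounce (\<gamma> t)) $ i) \<in> bounce_algebra"
    and T2: "(\<lambda>t. tangent (tangent \<gamma>') (bounce (\<gamma> t)) $ i) \<in> bounce_algebra"
    and TX: "(\<lambda>t. tangent \<gamma> t $ i) \<in> bounce_algebra" for i
    using periodic_nth_in_algebra[of "tangent \<gamma>'", OF smooth_derivative[OF Y.smooth] Y.tangent_periodic]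
      periodic_nth_in_algebra[of "tangent (tangent \<gamma>')", OF smooth_derivative[OF smooth_derivative[OF Y.smooth]] Y.tangent2_periodic]
      smooth_nth_in_algebra[of "tangent \<gamma>", OF smooth_derivative[OF X.smooth]] by blast+
  have P: "(\<lambda>t. phase_deriv2 (bounce (\<gamma> t))) \<in> bounce_algebra"
    by (intro smooth_algebra.periodic[where b = phase_deriv2] smooth_derivative smooth_phase_deriv
        vector_derivative_periodic[of phase_deriv] phase_deriv_periodic)
  note dT = inner_in_algebra[OF new_direction_in_algebra T]
  have H: "(\<lambda>t. hessian (\<gamma> t) (bounce (\<gamma> t))) \<in> bounce_algebra"
    unfolding hessian_def new_direction_def[symmetric] power2_eq_square
    by (intro smooth_algebra.add smooth_algebra_diff smooth_algebra_divide P dT distance_in_algebra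
        inner_in_algebra[OF new_direction_in_algebra T2] smooth_algebra.smooth[OF smooth_const] smooth_algebra.mult)
      (simp add: ne[OF X.in_set Y.in_set])
  have "hessian (\<gamma> t) (bounce (\<gamma> t)) \<noteq> 0" for t
    using hessian_pos[OF X.in_set bounce(2)[OF X.in_set], of t] by simp
  then show ?thesis
    unfolding bounce_speed_def[abs_def] Let_def
    by (intro smooth_algebra_divide smooth_algebra_diff smooth_algebra.mult H distance_in_algebra dT
        inner_in_algebra[OF TX T] inner_in_algebra[OF TX new_direction_in_algebra])
      (simp_all add: ne[OF X.in_set Y.in_set])
qed

text \<open>The derivative along \<open>\<gamma>\<close> is the tangential part of
  \<open>new_direction\<close>, in which no derivative of \<open>bounce\<close> occurs, and it lies
  in the algebra.\<close>

lemma smooth_new_phase: "smooth (\<lambda>t. new_phase (\<gamma> t))"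
proof (rule smooth_antiderivative)
  fix t
  have "(new_phase has_derivative (\<lambda>v. new_direction (\<gamma> t) \<bullet> v)) (at (\<gamma> t) within range \<gamma>)"
    by (rule has_derivative_subset[OF new_phase_gradient[OF X.in_set]]) (use X.in_set in auto)
  from has_derivative_in_compose[OF X.has_tangent[of t, unfolded has_vector_derivative_def] this]
  show "((\<lambda>t. new_phase (\<gamma> t)) has_vector_derivative new_direction (\<gamma> t) \<bullet> tangent \<gamma> t) (at t)"
    unfolding has_vector_derivative_def by (rule has_derivative_eq_rhs) (simp add: fun_eq_iff)
next
  show "smooth (\<lambda>t. new_direction (\<gamma> t) \<bullet> tangent \<gamma> t)"
    by (rule smooth_algebra_imp_smooth[OF bounce_speed_in_algebra bounce_has_derivative])
      (intro inner_in_algebra new_direction_in_algebra smooth_nth_in_algebra smooth_derivative X.smooth | assumption)+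
qed

text \<open>The induction step for the phases; the two obstacles exchange roles.\<close>

lemma eikonal_new_phase: "eikonal_phase \<Omega>' \<Omega> \<gamma> new_phase new_direction"
  unfolding eikonal_phase_def
  using smooth_new_phase new_phase_gradient new_phase_subgradient new_direction_nonaligned
    unit_sgn[OF _ Y.in_set] by (simp add: new_direction_def)

end

section \<open>Decay of the amplitudes\<close>

context reflection
begin

context
  fixes \<phi> :: "real^2 \<Rightarrow> real"
  assumes agree: "\<And>y. y \<in> frontier \<Omega>' \<Longrightarrow> \<phi> y = \<Phi> y"
begin

text \<open>The operator reads a phase only at boundary points, so agreement there suffices to
  transfer everything proved for \<open>\<Phi>\<close>.\<close>

lemma combined_phase_agree: "combined_phase \<phi> x (\<gamma>' t) = combined_phase \<Phi> x (\<gamma>' t)"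
  by (simp add: combined_phase_def agree Y.in_frontier)

lemma visible_stationary_agree:
  assumes "x \<in> \<Omega>"
  shows "visible_stationary \<gamma>' L' \<phi> x y \<longleftrightarrow> y = \<gamma>' (bounce x)"
  using visible_stationary_iff[OF assms, of y]
  unfolding visible_stationary_def combined_phase_agree .

lemma stationary_point_agree:
  assumes "x \<in> \<Omega>"
  shows "stationary_point \<gamma>' L' \<phi> x = \<gamma>' (bounce x)"
  unfolding stationary_point_def visible_stationary_agree[OF assms] by simp

lemma phase_hessian_agree:
  assumes "x \<in> \<Omega>"
  shows "phase_hessian \<gamma>' L' \<phi> x (\<gamma>' (bounce x)) = hessian x (bounce x)"
  using phase_hessian_eq[OF assms] unfolding phase_hessian_def combined_phase_agree .

lemma admissible: "admissible_phase \<gamma> L \<gamma>' L' \<phi>"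
  unfolding admissible_phase_def X.image
  using smooth_phase X.frontier_subset hessian_pos[OF _ bounce(2)]
  by (auto simp: agree Y.in_frontier visible_stationary_agree stationary_point_agree phase_hessian_agree)

lemma kirchhoff_phase:
  assumes "x \<in> \<Omega>"
  shows "fst (kirchhoff \<gamma> L \<gamma>' L' (\<phi>, A)) x = new_phase x"
  by (simp add: kirchhoff_def stationary_point_agree[OF assms] combined_phase_agree new_phase_def)

text \<open>The incoming bound supplies \<open>c\<close>, the kernel \<open>v / sqrt r\<close> with
  \<open>v\<close> the new cosine, and the Hessian \<open>1 / sqrt H\<close>. Everything reduces to
  \<open>c\<^sup>2 * (1 + 2 * \<kappa> * \<rho>) \<le> r * H\<close>.\<close>

lemma kirchhoff_amplitude_le:
  assumes x: "x \<in> \<Omega>"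
    and "\<kappa> \<ge> 0" and \<kappa>: "\<kappa> \<le> curvature \<gamma>' (bounce x)"
    and "\<rho> \<ge> 0" and \<rho>: "\<rho> \<le> norm (x - \<gamma>' (bounce x))"
    and "B \<ge> 0" and B: "norm (A (\<gamma>' (bounce x))) \<le> B * \<bar>u (\<gamma>' (bounce x)) \<bullet> Y.normal (bounce x)\<bar>"
  shows "norm (snd (kirchhoff \<gamma> L \<gamma>' L' (\<phi>, A)) x)
    \<le> B * (1 / sqrt (1 + 2 * \<kappa> * \<rho>)) * \<bar>new_direction x \<bullet> exterior_normal \<gamma> L x\<bar>"
proof -
  define t where "t = bounce x"
  define r c H v where "r = norm (x - \<gamma>' t)" and "c = sgn (x - \<gamma>' t) \<bullet> Y.normal t"
    and "H = hessian x t" and "v = \<bar>new_direction x \<bullet> exterior_normal \<gamma> L x\<bar>"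
  have refl: "reflects x t" unfolding t_def by (rule bounce(2)[OF x])
  have r: "r > 0" using ne[OF x Y.in_set] by (simp add: r_def)
  have c: "c > 0" "\<bar>u (\<gamma>' t) \<bullet> Y.normal t\<bar> = c"
    using reflects_inner(1,2)[OF x refl] by (simp_all add: c_def)
  have "c \<le> 1"
    using norm_cauchy_schwarz[of "sgn (x - \<gamma>' t)" "Y.normal t"] unit_sgn[OF x Y.in_set, of t]
    by (simp add: c_def Y.norm_normal)
  have H: "H > 0" unfolding H_def by (rule hessian_pos[OF x refl])
  have "c\<^sup>2 * (1 + 2 * \<kappa> * \<rho>) \<le> r * H"
  proof -
    \<comment> \<open>The curvature term of the Hessian is only linear in \<open>c\<close>;
      weakening \<open>c\<close> to \<open>c\<^sup>2\<close> lets the square of the cosine factor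
      out.\<close>
    have "c\<^sup>2 * (\<kappa> * \<rho>) \<le> c * (curvature \<gamma>' t * r)"
    proof (intro mult_mono)
      show "c\<^sup>2 \<le> c" using c(1) \<open>c \<le> 1\<close> by (simp add: power2_eq_square mult_left_le)
    qed (use \<kappa> \<rho> assms(2,4) c(1) in \<open>auto simp: t_def r_def\<close>)
    then have "c\<^sup>2 * (1 + 2 * \<kappa> * \<rho>) \<le> r * (c\<^sup>2 / r + 2 * curvature \<gamma>' t * c)"
      using r by (simp add: algebra_simps)
    also have "\<dots> \<le> r * H"
      using hessian_ge[OF x refl] r unfolding H_def c_def r_def by (intro mult_left_mono) auto
    finally show ?thesis .
  qed
  then have "sqrt (c\<^sup>2 * (1 + 2 * \<kappa> * \<rho>)) \<le> sqrt (r * H)" by (rule real_sqrt_le_mono)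
  then have le: "c * sqrt (1 + 2 * \<kappa> * \<rho>) \<le> sqrt r * sqrt H"
    using c(1) by (simp add: real_sqrt_mult)
  have s: "sqrt (1 + 2 * \<kappa> * \<rho>) > 0" using assms(2,4) by (simp add: add_pos_nonneg)
  have K: "\<bar>kernel_F \<gamma> L x (\<gamma>' t)\<bar> = v / sqrt r"
    unfolding kernel_F_def v_def r_def new_direction_def t_def[symmetric]
    by (simp add: abs_mult sgn_div_norm)
  have HH: "H powr (- 1 / 2) = 1 / sqrt H"
    using powr_minus_divide[of H "1/2"] H by (simp add: powr_half_sqrt)
  have "norm (snd (kirchhoff \<gamma> L \<gamma>' L' (\<phi>, A)) x) \<le> norm (A (\<gamma>' t)) * (v / sqrt r * (1 / sqrt H))"
    unfolding kirchhoff_def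
    using H r K HH phase_hessian_agree[OF x]
    by (auto simp: Let_def stationary_point_agree[OF x] t_def H_def norm_mult norm_divide abs_mult v_def)
  also have "\<dots> \<le> B * c * (v / sqrt r * (1 / sqrt H))"
    using B c(2) H r by (intro mult_right_mono) (auto simp: t_def v_def)
  also have "\<dots> = B * v * (c / (sqrt r * sqrt H))" by simp
  also have "\<dots> \<le> B * v * (1 / sqrt (1 + 2 * \<kappa> * \<rho>))"
    using le s r H \<open>B \<ge> 0\<close> by (intro mult_left_mono) (auto simp: v_def field_simps)
  finally show ?thesis by (simp add: v_def mult_ac)
qed

end

end

text \<open>The amplitude is compared with the cosine of the angle of incidence, and only at the
  points that actually reflect towards \<open>\<Omega>\<close>: the cosines then cancel along a chain of
  reflections.\<close>

definition controlled_wave ::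
    "(real^2) set \<Rightarrow> (real^2) set \<Rightarrow> (real \<Rightarrow> real^2) \<Rightarrow> real \<Rightarrow> real \<Rightarrow> wave \<Rightarrow> bool" where
  "controlled_wave \<Omega> \<Omega>' \<gamma>' L' B w \<longleftrightarrow> (\<exists>\<Phi> u. eikonal_phase \<Omega> \<Omega>' \<gamma>' \<Phi> u \<and>
     (\<forall>y\<in>frontier \<Omega>'. fst w y = \<Phi> y) \<and>
     (\<forall>x\<in>\<Omega>. \<forall>y\<in>frontier \<Omega>'. \<forall>c>0. sgn (x - y) - u y = c *\<^sub>R exterior_normal \<gamma>' L' y \<longrightarrow>
        norm (snd w y) \<le> B * \<bar>u y \<bullet> exterior_normal \<gamma>' L' y\<bar>))"

locale obstacle_pair = X: obstacle \<Omega> \<gamma> L + Y: obstacle \<Omega>' \<gamma>' L'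
  for \<Omega> \<Omega>' :: "(real^2) set" and \<gamma> \<gamma>' :: "real \<Rightarrow> real^2" and L L' :: real +
  assumes disjoint: "\<Omega> \<inter> \<Omega>' = {}"
begin

lemma reflectionI: "eikonal_phase \<Omega> \<Omega>' \<gamma>' \<Phi> u \<Longrightarrow> reflection \<Omega> \<Omega>' \<gamma> \<gamma>' L L' \<Phi> u"
  using disjoint by unfold_locales auto

lemma distance_pos: "\<exists>\<rho>>0. \<forall>x\<in>\<Omega>. \<forall>y\<in>\<Omega>'. \<rho> \<le> norm (x - y)"
  using separate_compact_closed[OF X.compact Y.closed disjoint] by (simp add: dist_norm)

lemma controlled_wave_admissible:
  assumes "controlled_wave \<Omega> \<Omega>' \<gamma>' L' B w"
  shows "admissible_phase \<gamma> L \<gamma>' L' (fst w)"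
  using assms reflection.admissible[OF reflectionI] unfolding controlled_wave_def by blast

text \<open>The first conclusion keeps the new cosine for the next step; the second drops it, being
  at most 1, to bound the sup norm.\<close>

lemma kirchhoff_controlled:
  assumes w: "controlled_wave \<Omega> \<Omega>' \<gamma>' L' B w" and "B \<ge> 0"
    and \<kappa>: "\<kappa> \<ge> 0" "\<And>t. \<kappa> \<le> curvature \<gamma>' t"
    and \<rho>: "\<rho> \<ge> 0" "\<And>x y. x \<in> \<Omega> \<Longrightarrow> y \<in> \<Omega>' \<Longrightarrow> \<rho> \<le> norm (x - y)"
  defines "q \<equiv> 1 / sqrt (1 + 2 * \<kappa> * \<rho>)"
  shows "controlled_wave \<Omega>' \<Omega> \<gamma> L (B * q) (kirchhoff \<gamma> L \<gamma>' L' w)"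
    and "x \<in> frontier \<Omega> \<Longrightarrow> norm (snd (kirchhoff \<gamma> L \<gamma>' L' w) x) \<le> B * q"
proof -
  obtain \<phi> A where wA: "w = (\<phi>, A)" by (cases w)
  obtain \<Phi> u where eik: "eikonal_phase \<Omega> \<Omega>' \<gamma>' \<Phi> u"
    and agree: "\<And>y. y \<in> frontier \<Omega>' \<Longrightarrow> \<phi> y = \<Phi> y"
    and amp: "\<And>x y c. x \<in> \<Omega> \<Longrightarrow> y \<in> frontier \<Omega>' \<Longrightarrow> c > 0 \<Longrightarrow>
      sgn (x - y) - u y = c *\<^sub>R exterior_normal \<gamma>' L' y \<Longrightarrow>
      norm (A y) \<le> B * \<bar>u y \<bullet> exterior_normal \<gamma>' L' y\<bar>"
    using w unfolding controlled_wave_def wA by auto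
  interpret reflection \<Omega> \<Omega>' \<gamma> \<gamma>' L L' \<Phi> u by (rule reflectionI[OF eik])
  have q: "q \<ge> 0" using \<kappa>(1) \<rho>(1) by (simp add: q_def)
  have bound: "norm (snd (kirchhoff \<gamma> L \<gamma>' L' w) x) \<le> B * q * \<bar>new_direction x \<bullet> exterior_normal \<gamma> L x\<bar>"
    if x: "x \<in> \<Omega>" for x
    unfolding wA q_def
  proof (rule kirchhoff_amplitude_le[OF agree x \<kappa>(1,2) \<rho>(1) \<rho>(2)[OF x Y.in_set] \<open>B \<ge> 0\<close>])
    have n: "exterior_normal \<gamma>' L' (\<gamma>' (bounce x)) = Y.normal (bounce x)"
      by (simp add: exterior_normal_def param_bounce[OF x])
    obtain c where "c > 0" "sgn (x - \<gamma>' (bounce x)) - u (\<gamma>' (bounce x)) = c *\<^sub>R Y.normal (bounce x)"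
      using bounce(2)[OF x] unfolding reflects_def by blast
    then show "norm (A (\<gamma>' (bounce x))) \<le> B * \<bar>u (\<gamma>' (bounce x)) \<bullet> Y.normal (bounce x)\<bar>"
      using amp[OF x Y.in_frontier, of c "bounce x"] unfolding n by simp
  qed
  show "controlled_wave \<Omega>' \<Omega> \<gamma> L (B * q) (kirchhoff \<gamma> L \<gamma>' L' w)"
    unfolding controlled_wave_def
    using eikonal_new_phase kirchhoff_phase[OF agree, of _ A] bound X.frontier_subset
    by (intro exI[of _ new_phase] exI[of _ new_direction]) (auto simp: wA)
  show "norm (snd (kirchhoff \<gamma> L \<gamma>' L' w) x) \<le> B * q" if "x \<in> frontier \<Omega>"
  proof -
    have x: "x \<in> \<Omega>" using that X.frontier_subset by blast
    have "\<bar>new_direction x \<bullet> exterior_normal \<gamma> L x\<bar> \<le> norm (new_direction x) * norm (exterior_normal \<gamma> L x)"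
      by (rule Cauchy_Schwarz_ineq2)
    also have "\<dots> = 1"
      using unit_sgn[OF x Y.in_set] by (simp add: new_direction_def exterior_normal_def X.norm_normal)
    finally show ?thesis
      using bound[OF x] mult_left_le[of _ "B * q"] \<open>B \<ge> 0\<close> q by (meson mult_nonneg_nonneg order_trans)
  qed
qed

text \<open>Since \<open>h0\<close> carries no cosine, no bound of this form can be expected at
  grazing points. At a point reflecting towards \<open>\<Omega>\<close>, the outgoing direction
  leaves the line of \<open>\<alpha>\<close> by at least some \<open>m > 0\<close>, by compactness
  and separation. As it differs from \<open>\<alpha>\<close> by twice the cosine times the normal,
  the cosine is at least \<open>m / 2\<close>; hence the constant \<open>2 * M / m\<close>.\<close>

lemma plane_wave_controlled:
  assumes \<alpha>: "norm \<alpha> = 1"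
    and sep: "\<And>x y. x \<in> \<Omega> \<Longrightarrow> y \<in> \<Omega>' \<Longrightarrow> (x - y) \<bullet> rot_left \<alpha> \<noteq> 0"
    and M: "\<And>y. y \<in> frontier \<Omega>' \<Longrightarrow> norm (h0 y) \<le> M"
  shows "\<exists>B\<ge>0. controlled_wave \<Omega> \<Omega>' \<gamma>' L' B ((\<lambda>x. \<alpha> \<bullet> x), h0)"
proof -
  have orth: "\<alpha> \<bullet> rot_left \<alpha> = 0" by (simp add: rot_left_eq rot_right_inner)
  have sgn_rot: "sgn (x - y) \<bullet> rot_left \<alpha> \<noteq> 0" if "x \<in> \<Omega>" "y \<in> \<Omega>'" for x y
    using sep[OF that] by (auto simp: sgn_div_norm)
  have nonaligned: "\<alpha> \<noteq> sgn (x - y)" if "x \<in> \<Omega>" "y \<in> \<Omega>'" for x y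
    using sgn_rot[OF that] orth by auto
  have eik: "eikonal_phase \<Omega> \<Omega>' \<gamma>' (\<lambda>x. \<alpha> \<bullet> x) (\<lambda>_. \<alpha>)"
    unfolding eikonal_phase_def
    using nonaligned \<alpha> smooth_bounded_linear[OF Y.smooth bounded_linear_inner_right]
    by (auto simp: inner_diff_right intro!: bounded_linear_imp_has_derivative bounded_linear_inner_right)
  interpret reflection \<Omega> \<Omega>' \<gamma> \<gamma>' L L' "\<lambda>x. \<alpha> \<bullet> x" "\<lambda>_. \<alpha>" by (rule reflectionI[OF eik])
  define f where "f p = \<bar>sgn (fst p - snd p) \<bullet> rot_left \<alpha>\<bar>" for p
  have "continuous_on (\<Omega> \<times> \<Omega>') f"
    unfolding f_def[abs_def] using ne by (intro continuous_intros) auto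
  moreover have "compact (\<Omega> \<times> \<Omega>')" "\<Omega> \<times> \<Omega>' \<noteq> {}"
    using X.compact Y.compact X.in_set Y.in_set by (auto intro: compact_Times)
  ultimately obtain p where p: "p \<in> \<Omega> \<times> \<Omega>'" "\<And>p'. p' \<in> \<Omega> \<times> \<Omega>' \<Longrightarrow> f p \<le> f p'"
    using continuous_attains_inf[of "\<Omega> \<times> \<Omega>'" f] by blast
  define m where "m = f p"
  have m: "m > 0" using sgn_rot p(1) by (auto simp: m_def f_def)
  have M0: "M \<ge> 0" using M[OF Y.in_frontier] norm_ge_zero order_trans by blast
  have "norm (h0 y) \<le> 2 * M / m * \<bar>\<alpha> \<bullet> exterior_normal \<gamma>' L' y\<bar>"
    if x: "x \<in> \<Omega>" and y: "y \<in> frontier \<Omega>'" and c: "c > 0"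
      "sgn (x - y) - \<alpha> = c *\<^sub>R exterior_normal \<gamma>' L' y" for x y c
  proof -
    define t where "t = param \<gamma>' L' y"
    have t: "\<gamma>' t = y" "exterior_normal \<gamma>' L' y = Y.normal t"
      using Y.param[OF y] by (simp_all add: t_def exterior_normal_def)
    have "reflects x t" unfolding reflects_def t using c unfolding t by blast
    note r = reflects_inner[OF x this]
    have "m \<le> f (x, y)"
      unfolding m_def using x y Y.frontier_subset by (intro p(2)) auto
    also have "f (x, y) = \<bar>(sgn (x - y) - \<alpha>) \<bullet> rot_left \<alpha>\<bar>"
      by (simp add: f_def inner_diff_left orth)
    also have "\<dots> \<le> norm (sgn (x - y) - \<alpha>) * norm (rot_left \<alpha>)" by (rule Cauchy_Schwarz_ineq2)
    also have "\<dots> = 2 * \<bar>\<alpha> \<bullet> Y.normal t\<bar>"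
      using r(1,2) unfolding r(4)[unfolded t] by (simp add: rot_left_eq norm_rot_right \<alpha> Y.norm_tangent t(1))
    finally have "M * m \<le> M * (2 * \<bar>\<alpha> \<bullet> Y.normal t\<bar>)" using M0 by (rule mult_left_mono)
    moreover have "norm (h0 y) * m \<le> M * m" using M[OF y] m by simp
    ultimately have "norm (h0 y) * m \<le> M * (2 * \<bar>\<alpha> \<bullet> Y.normal t\<bar>)" by linarith
    then show ?thesis unfolding t using m by (simp add: field_simps)
  qed
  then have "controlled_wave \<Omega> \<Omega>' \<gamma>' L' (2 * M / m) ((\<lambda>x. \<alpha> \<bullet> x), h0)"
    unfolding controlled_wave_def using eik
    by (intro exI[of _ "\<lambda>x. \<alpha> \<bullet> x"] exI[of _ "\<lambda>_. \<alpha>"]) auto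
  then show ?thesis using M0 m by (intro exI[of _ "2 * M / m"]) auto
qed

end

section \<open>Summation over the iterates\<close>

lemma controlled_wave_mono:
  assumes "controlled_wave \<Omega> \<Omega>' \<gamma>' L' B w" "B \<le> B'"
  shows "controlled_wave \<Omega> \<Omega>' \<gamma>' L' B' w"
proof -
  have "B * \<bar>z\<bar> \<le> B' * \<bar>z\<bar>" for z using assms(2) by (simp add: mult_right_mono)
  then have le: "n \<le> B * \<bar>z\<bar> \<Longrightarrow> n \<le> B' * \<bar>z\<bar>" for n z by (rule order_trans[rotated])
  obtain \<Phi> u where "eikonal_phase \<Omega> \<Omega>' \<gamma>' \<Phi> u" "\<forall>y\<in>frontier \<Omega>'. fst w y = \<Phi> y"
    "\<forall>x\<in>\<Omega>. \<forall>y\<in>frontier \<Omega>'. \<forall>c>0. sgn (x - y) - u y = c *\<^sub>R exterior_normal \<gamma>' L' y \<longrightarrow>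
        norm (snd w y) \<le> B * \<bar>u y \<bullet> exterior_normal \<gamma>' L' y\<bar>"
    using assms(1) unfolding controlled_wave_def by blast
  then show ?thesis
    unfolding controlled_wave_def by (intro exI[of _ \<Phi>] exI[of _ u] conjI ballI allI impI le) auto
qed

text \<open>Around a point of one set the complement of the other is an open neighbourhood, so there
  the interior of the union is contained in the first set.\<close>

lemma frontier_Un_disjoint_closed:
  fixes S T :: "'a::topological_space set"
  assumes "closed S" "closed T" "S \<inter> T = {}"
  shows "frontier (S \<union> T) = frontier S \<union> frontier T"
proof
  show "frontier (S \<union> T) \<subseteq> frontier S \<union> frontier T" by (rule frontier_Un_subset)
  have *: "frontier S \<subseteq> frontier (S \<union> T)" if "closed S" "closed T" "S \<inter> T = {}" for S T :: "'a set"
  proof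
    fix x assume x: "x \<in> frontier S"
    have "x \<in> S" using x frontier_subset_closed[OF that(1)] by blast
    have "x \<notin> interior (S \<union> T)"
    proof
      assume "x \<in> interior (S \<union> T)"
      then have "x \<in> interior (S \<union> T) \<inter> - T" using \<open>x \<in> S\<close> that(3) by auto
      moreover have "interior (S \<union> T) \<inter> - T \<subseteq> S" using interior_subset by blast
      moreover have "open (interior (S \<union> T) \<inter> - T)" using that(2) by auto
      ultimately have "x \<in> interior S" by (meson interiorI)
      then show False using x by (simp add: frontier_def)
    qed
    moreover have "x \<in> closure (S \<union> T)" using \<open>x \<in> S\<close> closure_subset[of "S \<union> T"] by auto
    ultimately show "x \<in> frontier (S \<union> T)" by (simp add: frontier_def)
  qed
  show "frontier S \<union> frontier T \<subseteq> frontier (S \<union> T)"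
    using *[OF assms] *[of T S] assms by (simp add: Un_commute Int_commute)
qed

text \<open>The oscillating factor has modulus one, which makes all estimates uniform in
  \<open>k\<close>.\<close>

lemma norm_wave_value: "norm (wave_value k w x) = norm (snd w x)"
  by (cases w) (simp add: wave_value_def norm_mult)

theorem theorem11:
  fixes \<Omega>1 \<Omega>2 :: "(real^2) set"
    and \<gamma>1 \<gamma>2 :: "real \<Rightarrow> real^2" and L1 L2 :: real
    and \<alpha> :: "real^2" and k :: real
    and h h0 :: "real^2 \<Rightarrow> complex"
  assumes "smooth_strictly_convex \<Omega>1 \<gamma>1 L1"
    and "smooth_strictly_convex \<Omega>2 \<gamma>2 L2"
    and "\<Omega>1 \<inter> \<Omega>2 = {}"
    and "norm \<alpha> = 1"
    and "no_occlusion \<alpha> \<Omega>1 \<Omega>2"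
    and "k > 0"
    and "continuous_on (frontier (\<Omega>1 \<union> \<Omega>2)) h"
    and "\<And>x. x \<in> frontier (\<Omega>1 \<union> \<Omega>2) \<Longrightarrow> h x = exp (\<i> * of_real (k * (\<alpha> \<bullet> x))) * h0 x"
  defines "w \<equiv> kirchhoff_power \<gamma>1 L1 \<gamma>2 L2 \<alpha> h0"
  shows "(\<forall>l. admissible_phase \<gamma>2 L2 \<gamma>1 L1 (fst (fst (w l))) \<and>
              admissible_phase \<gamma>1 L1 \<gamma>2 L2 (fst (snd (w l))) \<and>
              bounded (pair_value \<Omega>1 k (w l) ` frontier (\<Omega>1 \<union> \<Omega>2))) \<and>
         summable (\<lambda>l. sup_norm_on (frontier (\<Omega>1 \<union> \<Omega>2)) (pair_value \<Omega>1 k (w l)))"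
proof -
  \<comment> \<open>In \<open>A\<close> waves travel from \<open>\<Omega>2\<close> to
    \<open>\<Omega>1\<close>, in \<open>B\<close> the other way.\<close>
  interpret A: obstacle_pair \<Omega>1 \<Omega>2 \<gamma>1 \<gamma>2 L1 L2
    using assms(1-3) by unfold_locales
  interpret B: obstacle_pair \<Omega>2 \<Omega>1 \<gamma>2 \<gamma>1 L2 L1
    using assms(3) by unfold_locales auto
  define F where "F = frontier (\<Omega>1 \<union> \<Omega>2)"
  have F: "F = frontier \<Omega>1 \<union> frontier \<Omega>2"
    unfolding F_def by (rule frontier_Un_disjoint_closed[OF A.X.closed A.Y.closed assms(3)])
  have "compact F" unfolding F using A.X.compact A.Y.compact by (intro compact_Un compact_frontier)
  then obtain M where M: "\<And>x. x \<in> F \<Longrightarrow> norm (h x) \<le> M"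
    using compact_imp_bounded[OF compact_continuous_image[OF assms(7)[folded F_def]]]
    unfolding bounded_iff by blast
  have h0: "norm (h0 x) \<le> M" if "x \<in> F" for x
    using M[OF that] assms(8)[folded F_def, OF that] by (simp add: norm_mult)
  have M0: "M \<ge> 0" using A.X.in_frontier M norm_ge_zero order_trans unfolding F by blast
  obtain p where "(\<forall>x\<in>\<Omega>1. (x - p) \<bullet> rot_left \<alpha> > 0) \<and> (\<forall>x\<in>\<Omega>2. (x - p) \<bullet> rot_left \<alpha> < 0) \<or>
     (\<forall>x\<in>\<Omega>1. (x - p) \<bullet> rot_left \<alpha> < 0) \<and> (\<forall>x\<in>\<Omega>2. (x - p) \<bullet> rot_left \<alpha> > 0)"
    using assms(5) unfolding no_occlusion_def by blast
  then have sep: "(x - y) \<bullet> rot_left \<alpha> \<noteq> 0" "(y - x) \<bullet> rot_left \<alpha> \<noteq> 0"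
    if "x \<in> \<Omega>1" "y \<in> \<Omega>2" for x y
    using that by (fastforce simp: inner_diff_left)+
  obtain B1 B2 where B12: "B1 \<ge> 0" "controlled_wave \<Omega>1 \<Omega>2 \<gamma>2 L2 B1 ((\<lambda>x. \<alpha> \<bullet> x), h0)"
    "B2 \<ge> 0" "controlled_wave \<Omega>2 \<Omega>1 \<gamma>1 L1 B2 ((\<lambda>x. \<alpha> \<bullet> x), h0)"
    using A.plane_wave_controlled[OF assms(4) sep(1), of h0 M]
      B.plane_wave_controlled[OF assms(4) sep(2), of h0 M] h0 unfolding F by blast
  define C where "C = max B1 B2"
  have C: "C \<ge> 0" using B12 by (simp add: C_def)
  obtain \<kappa>1 \<kappa>2 where \<kappa>12: "\<kappa>1 > 0" "\<And>t. \<kappa>1 \<le> curvature \<gamma>1 t" "\<kappa>2 > 0" "\<And>t. \<kappa>2 \<le> curvature \<gamma>2 t"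
    using A.X.curvature_lower_bound A.Y.curvature_lower_bound by blast
  define \<kappa> where "\<kappa> = min \<kappa>1 \<kappa>2"
  have \<kappa>: "\<kappa> > 0" "\<kappa> \<le> curvature \<gamma>1 t" "\<kappa> \<le> curvature \<gamma>2 t" for t
    using \<kappa>12(1,3) \<kappa>12(2,4)[of t] by (auto simp: \<kappa>_def)
  obtain \<rho> where \<rho>: "\<rho> > 0" "\<And>x y. x \<in> \<Omega>1 \<Longrightarrow> y \<in> \<Omega>2 \<Longrightarrow> \<rho> \<le> norm (x - y)"
    using A.distance_pos by blast
  have \<rho>': "\<rho> \<le> norm (x - y)" if "x \<in> \<Omega>2" "y \<in> \<Omega>1" for x y
    using \<rho>(2)[OF that(2,1)] by (simp add: norm_minus_commute)
  define q where "q = 1 / sqrt (1 + 2 * \<kappa> * \<rho>)"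
  have "\<kappa> * \<rho> > 0" using \<kappa>(1) \<rho>(1) by simp
  then have q: "0 \<le> q" "q < 1" by (simp_all add: q_def)
  have w_Suc: "fst (w (Suc l)) = kirchhoff \<gamma>1 L1 \<gamma>2 L2 (snd (w l))"
    "snd (w (Suc l)) = kirchhoff \<gamma>2 L2 \<gamma>1 L1 (fst (w l))" for l
    by (simp_all add: w_def kirchhoff_power_def kirchhoff_matrix_def case_prod_beta)
  have w: "controlled_wave \<Omega>1 \<Omega>2 \<gamma>2 L2 (C * q ^ l) (snd (w l)) \<and>
      controlled_wave \<Omega>2 \<Omega>1 \<gamma>1 L1 (C * q ^ l) (fst (w l))" for l
  proof (induction l)
    case 0
    then show ?case
      using controlled_wave_mono[OF B12(2), of C] controlled_wave_mono[OF B12(4), of C]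
      by (simp add: w_def kirchhoff_power_def C_def)
  next
    case (Suc l)
    have "controlled_wave \<Omega>2 \<Omega>1 \<gamma>1 L1 (C * q ^ l * q) (fst (w (Suc l)))"
      unfolding w_Suc(1) q_def
      by (rule A.kirchhoff_controlled(1)) (use Suc.IH C q \<kappa> \<rho> in \<open>auto simp: q_def less_imp_le\<close>)
    moreover have "controlled_wave \<Omega>1 \<Omega>2 \<gamma>2 L2 (C * q ^ l * q) (snd (w (Suc l)))"
      unfolding w_Suc(2) q_def
      by (rule B.kirchhoff_controlled(1)) (use Suc.IH C q \<kappa> \<rho>(1) \<rho>' in \<open>auto simp: q_def less_imp_le\<close>)
    ultimately show ?case by (simp add: mult_ac)
  qed
  have amp: "norm (pair_value \<Omega>1 k (w (Suc l)) x) \<le> C * q ^ Suc l" if "x \<in> F" for l x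
  proof (cases "x \<in> frontier \<Omega>1")
    case True
    have "norm (snd (fst (w (Suc l))) x) \<le> C * q ^ l * q"
      unfolding w_Suc(1) q_def
      by (rule A.kirchhoff_controlled(2)[OF conjunct1[OF w, unfolded q_def]])
        (use True C q \<kappa> \<rho> in \<open>auto simp: q_def less_imp_le\<close>)
    with True show ?thesis by (simp add: pair_value_def case_prod_beta norm_wave_value mult_ac)
  next
    case False
    then have x: "x \<in> frontier \<Omega>2" using that F by blast
    have "norm (snd (snd (w (Suc l))) x) \<le> C * q ^ l * q"
      unfolding w_Suc(2) q_def
      by (rule B.kirchhoff_controlled(2)[OF conjunct2[OF w, unfolded q_def]])
        (use x C q \<kappa> \<rho>(1) \<rho>' in \<open>auto simp: q_def less_imp_le\<close>)
    with False show ?thesis by (simp add: pair_value_def case_prod_beta norm_wave_value mult_ac)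
  qed
  have amp0: "norm (pair_value \<Omega>1 k (w 0) x) \<le> M" if "x \<in> F" for x
    using h0[OF that] by (simp add: w_def kirchhoff_power_def pair_value_def norm_wave_value)
  \<comment> \<open>The term \<open>l = 0\<close> needs its own bound:
    \<open>controlled_wave\<close> limits \<open>h0\<close> only at points that reflect towards the
    other obstacle, so \<open>C\<close> need not dominate it everywhere.\<close>
  define b where "b l = (if l = 0 then M else C * q ^ l)" for l :: nat
  have bound: "norm (pair_value \<Omega>1 k (w l) x) \<le> b l" if "x \<in> F" for l x
    using amp[OF that] amp0[OF that] by (cases l) (auto simp: b_def)
  have "F \<noteq> {}" using A.X.in_frontier unfolding F by blast
  have sup: "norm (sup_norm_on F (pair_value \<Omega>1 k (w l))) \<le> b l" for l
  proof -
    have "bdd_above ((\<lambda>x. norm (pair_value \<Omega>1 k (w l) x)) ` F)" using bound by (auto intro!: bdd_aboveI2)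
    then have "0 \<le> sup_norm_on F (pair_value \<Omega>1 k (w l))"
      unfolding sup_norm_on_def using \<open>F \<noteq> {}\<close> by (metis cSUP_upper2 ex_in_conv norm_ge_zero)
    moreover have "sup_norm_on F (pair_value \<Omega>1 k (w l)) \<le> b l"
      unfolding sup_norm_on_def using \<open>F \<noteq> {}\<close> bound by (rule cSUP_least)
    ultimately show ?thesis by simp
  qed
  have "summable (\<lambda>l. C * q ^ Suc l)"
    using q by (intro summable_mult summable_Suc_iff[THEN iffD2] summable_geometric) simp
  then have "summable (\<lambda>l. b (Suc l))" by (simp add: b_def)
  then have "summable b" by (simp only: summable_Suc_iff)
  then have "summable (\<lambda>l. sup_norm_on F (pair_value \<Omega>1 k (w l)))"
    by (rule summable_comparison_test'[where N = 0]) (rule sup)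
  moreover have "bounded (pair_value \<Omega>1 k (w l) ` F)" for l
    using bound by (auto simp: bounded_iff)
  moreover have "admissible_phase \<gamma>1 L1 \<gamma>2 L2 (fst (snd (w l)))"
    "admissible_phase \<gamma>2 L2 \<gamma>1 L1 (fst (fst (w l)))" for l
    by (rule A.controlled_wave_admissible[OF conjunct1[OF w]],
        rule B.controlled_wave_admissible[OF conjunct2[OF w]])
  ultimately show ?thesis unfolding F_def by simp
qed

end
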